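(* Let $\mathcal{A}(z)$, $A(k)$, $\lambda_A^j$ and $\mathcal{P}_{\mathcal{A}}$ be as in the context, and assume $\mathcal{P}_{\mathcal{A}}(z,\lambda)$ is irreducible. Then for every real $a\ne0$ and every $\alpha\in\mathbb{R}^d$, the set $$\{k\in\mathbb{R}^d:\ \text{there exist } s,w\in\{1,\dots,Q\} \text{ such that } \lambda_A^s(k+\alpha)=\lambda_A^w(k)+a\}$$ has Lebesgue measure zero.
   Context: Let $d,Q\ge1$ and $\mathbb{C}^\star=\mathbb{C}\setminus\{0\}$. Let $\mathcal{A}(z)$ be a $Q\times Q$ matrix each of whose entries is a Laurent polynomial in $z=(z_1,\dots,z_d)\in(\mathbb{C}^\star)^d$ with complex coefficients. Set $A(k)=\mathcal{A}(z)$ with $z_j=e^{2\pi i k_j}$, $k\in\mathbb{R}^d$, and assume $A(k)$ is Hermitian for every $k\in\mathbb{R}^d$. Denote by $\lambda_A^1(k)\le\cdots\le\lambda_A^Q(k)$ the eigenvalues of $A(k)$ in non-decreasing order. Let $\mathcal{P}_{\mathcal{A}}(z,\lambda)=\det(\mathcal{A}(z)-\lambda I_{Q\times Q})$, a Laurent polynomial in $z$ and polynomial in $\lambda$; irreducibility is meant in the ring of Laurent polynomials in $z$ with polynomial dependence on $\lambda$ (up to units). *)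

theory Defs
  imports "HOL-Analysis.Analysis" "HOL-Library.Poly_Mapping"
    "HOL-Computational_Algebra.Polynomial" "HOL-Library.Multiset"
begin

text \<open>Laurent polynomials in z = (z_1,...,z_d): finitely supported coefficient
  functions on exponent vectors in Z^d (the index type 'd has d elements), with
  convolution product.\<close>
type_synonym 'd laurent = "(int ^ 'd) \<Rightarrow>\<^sub>0 complex"

definition laurent_eval :: "'d::finite laurent \<Rightarrow> complex ^ 'd \<Rightarrow> complex" where
  "laurent_eval p z = (\<Sum>m\<in>Poly_Mapping.keys p. Poly_Mapping.lookup p m * (\<Prod>j\<in>UNIV. (z $ j) powi (m $ j)))"

definition symb :: "('d::finite laurent) ^ 'q ^ 'q \<Rightarrow> real ^ 'd \<Rightarrow> complex ^ 'q ^ 'q" where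
  "symb Acal k = (\<chi> i j. laurent_eval (Acal $ i $ j)
                    (\<chi> l. exp (2 * of_real pi * \<i> * of_real (k $ l))))"

definition charP :: "('d::finite laurent) ^ 'q::finite ^ 'q \<Rightarrow> ('d laurent) poly" where
  "charP Acal = det (\<chi> i j. [:Acal $ i $ j:] - (if i = j then [:0, 1:] else 0))"

definition cpoly :: "complex ^ 'q::finite ^ 'q \<Rightarrow> complex poly" where
  "cpoly M = det (\<chi> i j. [:M $ i $ j:] - (if i = j then [:0, 1:] else 0))"

definition hermitian_mat :: "complex ^ 'q ^ 'q \<Rightarrow> bool" where
  "hermitian_mat M \<longleftrightarrow> (\<forall>i j. M $ i $ j = cnj (M $ j $ i))"

text \<open>The s-th eigenvalue (s = 1..Q) in non-decreasing order, counted with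
  multiplicity (real parts; for Hermitian matrices all eigenvalues are real).\<close>
definition eig :: "complex ^ 'q::finite ^ 'q \<Rightarrow> nat \<Rightarrow> real" where
  "eig M s = sorted_list_of_multiset (image_mset Re (proots (cpoly M))) ! (s - 1)"

end

theory Submission
  imports Defs "HOL-Computational_Algebra.Fundamental_Theorem_Algebra"
begin

text \<open>Compare \<open>F = P(z, \<lambda>)\<close> with \<open>G = P(w z, \<lambda> + a)\<close>, where \<open>w = (exp(2\<pi>i\<alpha>\<^sub>j))\<^sub>j\<close>; both have leading term
  \<open>(-\<lambda>)\<^sup>Q\<close>. A point of the exceptional set yields a common root \<open>\<lambda>\<close> of \<open>F\<close> and \<open>G\<close>. Take an
  element \<open>D\<close> of least \<open>\<lambda>\<close>-degree in the ideal \<open>(F, G)\<close>. If it is a Laurent polynomial in \<open>z\<close> alone,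
  the exceptional set lies in its zero set, which is null. Otherwise \<open>D\<close> divides multiples of \<open>F\<close> and
  of \<open>G\<close> by nonzero Laurent polynomials. The ring of Laurent polynomials is completely integrally
  closed, so by the Dedekind-Mertens content formula \<open>D\<close> is, up to its leading coefficient, a monic
  factor of both, and irreducibility of \<open>F\<close> gives \<open>F = G\<close>. Comparing the terms of \<open>\<lambda>\<close>-degree
  \<open>Q - 1\<close> with trivial \<open>z\<close>-exponent then yields \<open>Q a = 0\<close>.\<close>

section \<open>The Dedekind-Mertens content formula\<close>

definition ideal_set :: "'a::comm_ring_1 set \<Rightarrow> bool" where
  "ideal_set X \<longleftrightarrow> 0 \<in> X \<and> (\<forall>x\<in>X. \<forall>y\<in>X. x + y \<in> X) \<and> (\<forall>r. \<forall>x\<in>X. r * x \<in> X)"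

text \<open>When \<open>X\<close> is an ideal this is the product c(D) X of \<open>X\<close> with
  the content ideal of \<open>D\<close>: one multiplier in \<open>X\<close> per coefficient is
  enough. Iterating from \<open>UNIV\<close> gives the powers c(D)^n.\<close>

definition content_mult :: "'a::comm_ring_1 poly \<Rightarrow> 'a set \<Rightarrow> 'a set" where
  "content_mult D X = {(\<Sum>i\<le>degree D. coeff D i * x i) |x. \<forall>i. x i \<in> X}"

lemma content_multI: "(\<And>i. x i \<in> X) \<Longrightarrow> (\<Sum>i\<le>degree D. coeff D i * x i) \<in> content_mult D X"
  by (auto simp: content_mult_def)

lemma content_multE:
  assumes "z \<in> content_mult D X"
  obtains x where "z = (\<Sum>i\<le>degree D. coeff D i * x i)" "\<And>i. x i \<in> X"
  using assms by (auto simp: content_mult_def)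

lemma ideal_set_sum: "ideal_set X \<Longrightarrow> (\<And>i. i \<in> I \<Longrightarrow> f i \<in> X) \<Longrightarrow> sum f I \<in> X"
  by (induction I rule: infinite_finite_induct) (auto simp: ideal_set_def)

lemma ideal_set_diff: "ideal_set X \<Longrightarrow> x \<in> X \<Longrightarrow> y \<in> X \<Longrightarrow> x - y \<in> X"
  unfolding ideal_set_def by (metis add_uminus_conv_diff mult_minus1)

lemma ideal_set_content_mult:
  assumes "ideal_set X"
  shows "ideal_set (content_mult D X)"
  unfolding ideal_set_def
proof (intro conjI ballI allI)
  show "0 \<in> content_mult D X"
    using content_multI[of "\<lambda>_. 0" X D] assms by (simp add: ideal_set_def)
next
  fix y z assume "y \<in> content_mult D X" "z \<in> content_mult D X"
  then obtain u v where u: "y = (\<Sum>i\<le>degree D. coeff D i * u i)" "\<And>i. u i \<in> X"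
    and v: "z = (\<Sum>i\<le>degree D. coeff D i * v i)" "\<And>i. v i \<in> X"
    by (elim content_multE) blast
  have "y + z = (\<Sum>i\<le>degree D. coeff D i * (u i + v i))"
    by (simp add: u v algebra_simps sum.distrib)
  then show "y + z \<in> content_mult D X"
    using u v assms by (auto intro!: content_multI simp: ideal_set_def)
next
  fix r z assume "z \<in> content_mult D X"
  then obtain v where v: "z = (\<Sum>i\<le>degree D. coeff D i * v i)" "\<And>i. v i \<in> X"
    by (elim content_multE) blast
  have "r * z = (\<Sum>i\<le>degree D. coeff D i * (r * v i))"
    by (simp add: v sum_distrib_left mult_ac)
  then show "r * z \<in> content_mult D X"
    using v assms by (auto intro!: content_multI simp: ideal_set_def)
qed

lemma ideal_set_UNIV: "ideal_set UNIV"
  by (simp add: ideal_set_def)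

lemma ideal_set_funpow: "ideal_set X \<Longrightarrow> ideal_set ((content_mult D ^^ n) X)"
  by (induction n) (auto intro: ideal_set_content_mult)

lemma coeff_content_mult:
  assumes "ideal_set X" "x \<in> X"
  shows "coeff D k * x \<in> content_mult D X"
proof -
  have "(\<Sum>i\<le>degree D. coeff D i * (if i = k then x else 0)) = coeff D k * x"
    by (cases "k \<le> degree D") (auto simp: if_distrib[of "(*) _"] coeff_eq_0 cong: if_cong)
  moreover have "(if i = k then x else 0) \<in> X" for i
    using assms by (auto simp: ideal_set_def)
  ultimately show ?thesis
    using content_multI[of "\<lambda>i. if i = k then x else 0" X D] by simp
qed

lemma content_mult_mono: "X \<subseteq> Y \<Longrightarrow> content_mult D X \<subseteq> content_mult D Y"
  by (auto simp: content_mult_def)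

lemma content_mult_add:
  "content_mult D {c + b * y |c y. c \<in> C \<and> y \<in> Y} \<subseteq>
     {c + b * y |c y. c \<in> content_mult D C \<and> y \<in> content_mult D Y}"
proof
  fix z assume "z \<in> content_mult D {c + b * y |c y. c \<in> C \<and> y \<in> Y}"
  then obtain x where x: "z = (\<Sum>i\<le>degree D. coeff D i * x i)"
    "\<And>i. x i \<in> {c + b * y |c y. c \<in> C \<and> y \<in> Y}"
    by (elim content_multE) blast
  then have "\<forall>i. \<exists>c y. x i = c + b * y \<and> c \<in> C \<and> y \<in> Y" by blast
  then obtain c y where cy: "\<And>i. x i = c i + b * y i" "\<And>i. c i \<in> C" "\<And>i. y i \<in> Y"
    by metis
  have "z = (\<Sum>i\<le>degree D. coeff D i * c i) + b * (\<Sum>i\<le>degree D. coeff D i * y i)"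
    by (simp add: x(1) cy(1) algebra_simps sum.distrib sum_distrib_left)
  then show "z \<in> {c + b * y |c y. c \<in> content_mult D C \<and> y \<in> content_mult D Y}"
    using content_multI[of c C D] content_multI[of y Y D] cy by blast
qed

text \<open>Serves the induction for Dedekind-Mertens, where splitting off the top term of
  \<open>S\<close> replaces the ideal C by C + b c(D).\<close>

lemma content_mult_funpow_add:
  "(content_mult D ^^ n) {c + b * y |c y. c \<in> C \<and> y \<in> Y} \<subseteq>
     {c + b * y |c y. c \<in> (content_mult D ^^ n) C \<and> y \<in> (content_mult D ^^ n) Y}"
proof (induction n)
  case (Suc n)
  show ?case
    unfolding funpow.simps comp_apply
    by (rule subset_trans[OF content_mult_mono[OF Suc.IH] content_mult_add])
qed simp

lemma mult_content_mult_funpow: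
  assumes "ideal_set C" "f \<in> C" "y \<in> (content_mult D ^^ n) UNIV"
  shows "f * y \<in> (content_mult D ^^ n) C"
  using assms(3)
proof (induction n arbitrary: y)
  case 0
  then show ?case using assms by (metis funpow_0 ideal_set_def mult.commute)
next
  case (Suc n)
  then obtain x where x: "y = (\<Sum>i\<le>degree D. coeff D i * x i)"
    "\<And>i. x i \<in> (content_mult D ^^ n) UNIV"
    by (auto elim: content_multE)
  have "f * y = (\<Sum>i\<le>degree D. coeff D i * (f * x i))"
    by (simp add: x sum_distrib_left mult_ac)
  then show ?case using Suc.IH x(2) by (auto intro!: content_multI)
qed

text \<open>Induction on the degree bound: removing the top term of \<open>S\<close>, with
  coefficient b, enlarges C to C + b c(D), and the resulting surplus is absorbed by descending
  induction over the coefficients of \<open>D\<close>. For C = c(D S) this is the classical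
  inclusion of c(D)^(s+1) c(S) in c(D)^s c(D S).\<close>

theorem dedekind_mertens:
  fixes D S :: "'a::comm_ring_1 poly"
  assumes "ideal_set C" "\<And>k. coeff (D * S) k \<in> C" "degree S \<le> s"
    "x \<in> (content_mult D ^^ Suc s) UNIV"
  shows "coeff S j * x \<in> (content_mult D ^^ s) C"
  using assms
proof (induction s arbitrary: S C x j)
  case 0
  then obtain b where b: "S = [:b:]" by (metis degree_eq_zeroE le_zero_eq)
  from 0 obtain y where y: "x = (\<Sum>i\<le>degree D. coeff D i * y i)"
    by (auto elim: content_multE)
  have "coeff D i * b \<in> C" for i using 0(2)[of i] by (simp add: b mult.commute)
  then have "(\<Sum>i\<le>degree D. y i * (coeff D i * b)) \<in> C"
    using 0(1) by (intro ideal_set_sum) (auto simp: ideal_set_def)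
  moreover have "(\<Sum>i\<le>degree D. y i * (coeff D i * b)) = b * x"
    by (simp add: y sum_distrib_left mult_ac)
  ultimately show ?case using 0(1) by (auto simp: b coeff_pCons ideal_set_def split: nat.splits)
next
  case (Suc t)
  let ?T = "content_mult D"
  define b where "b = coeff S (Suc t)"
  define S' where "S' = S - monom b (Suc t)"
  \<comment> \<open>The product of \<open>D\<close> with the truncated \<open>S'\<close> differs
    from \<open>D * S\<close> by b times shifted coefficients of \<open>D\<close>, so this ideal
    receives all its coefficients.\<close>
  define C' where "C' = {c + b * y |c y. c \<in> C \<and> y \<in> ?T UNIV}"
  have coS': "coeff S' j = (if j = Suc t then 0 else coeff S j)" for j
    by (simp add: S'_def b_def)
  have degS': "degree S' \<le> t"
    using Suc.prems(3) by (intro degree_le) (auto simp: coS' coeff_eq_0)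
  have TU: "ideal_set (?T UNIV)" by (intro ideal_set_content_mult ideal_set_UNIV)
  have idC': "ideal_set C'"
    unfolding ideal_set_def
  proof (intro conjI ballI allI)
    show "0 \<in> C'"
      using TU Suc.prems(1) by (force simp: C'_def ideal_set_def)
  next
    fix u v assume "u \<in> C'" "v \<in> C'"
    then obtain c1 y1 c2 y2 where *: "u = c1 + b * y1" "v = c2 + b * y2"
      "c1 \<in> C" "c2 \<in> C" "y1 \<in> ?T UNIV" "y2 \<in> ?T UNIV" by (auto simp: C'_def)
    then have "u + v = (c1 + c2) + b * (y1 + y2)" by (simp add: algebra_simps)
    then show "u + v \<in> C'"
      using * TU Suc.prems(1) unfolding C'_def ideal_set_def by blast
  next
    fix r u assume "u \<in> C'"
    then obtain c1 y1 where *: "u = c1 + b * y1" "c1 \<in> C" "y1 \<in> ?T UNIV" by (auto simp: C'_def)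
    then have "r * u = r * c1 + b * (r * y1)" by (simp add: algebra_simps)
    then show "r * u \<in> C'"
      using * TU Suc.prems(1) unfolding C'_def ideal_set_def by blast
  qed
  have coF': "coeff (D * S') k \<in> C'" for k
  proof -
    let ?y = "if k < Suc t then 0 else - coeff D (k - Suc t)"
    have "coeff (D * S') k = coeff (D * S) k + b * ?y"
      using coeff_monom_mult[of b "Suc t" D k]
      by (simp add: S'_def right_diff_distrib mult.commute[of D "monom b (Suc t)"])
    moreover have "?y \<in> ?T UNIV"
    proof -
      have "coeff D (k - Suc t) * (-1) \<in> ?T UNIV"
        by (intro coeff_content_mult ideal_set_UNIV) auto
      then show ?thesis using TU by (auto simp: ideal_set_def)
    qed
    ultimately show ?thesis using Suc.prems(2) unfolding C'_def by blast
  qed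
  \<comment> \<open>The induction hypothesis for \<open>S'\<close>: a coefficient of
    \<open>S\<close> other than the top one already lands in the required ideal, one power lower, up
    to a multiple of b.\<close>
  have low: "\<exists>u w. coeff S j * y = u + b * w \<and> u \<in> (?T ^^ t) C \<and> w \<in> (?T ^^ Suc t) UNIV"
    if "j \<noteq> Suc t" "y \<in> (?T ^^ Suc t) UNIV" for j y
  proof -
    have "coeff S' j * y \<in> (?T ^^ t) C'"
      by (rule Suc.IH[OF idC' coF' degS' that(2)])
    then have "coeff S j * y \<in> {c + b * y |c y. c \<in> (?T ^^ t) C \<and> y \<in> (?T ^^ t) (?T UNIV)}"
      using content_mult_funpow_add[of t D b C "?T UNIV"] that(1)
      unfolding C'_def[symmetric] by (auto simp: coS')
    then show ?thesis by (auto simp: funpow_swap1)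
  qed
  have idTC: "ideal_set ((?T ^^ n) C)" for n using Suc.prems(1) by (rule ideal_set_funpow)
  \<comment> \<open>Descending induction on i. In the coefficient of \<open>D * S\<close> at i + t +
    1 the summand with index i is the wanted product; smaller indices contribute 0 by degree, larger
    ones are rewritten by \<open>low\<close> into a term of the ideal plus a multiple of b covered
    by the induction hypothesis.\<close>
  have top: "coeff D i * b * y \<in> (?T ^^ Suc t) C" if "y \<in> (?T ^^ Suc t) UNIV" for i y
    using that
  proof (induction "degree D - i" arbitrary: i y rule: less_induct)
    case less
    show ?case
    proof (cases "i \<le> degree D")
      case False
      then show ?thesis using idTC[of "Suc t"] by (simp add: coeff_eq_0 ideal_set_def)
    next
      case True
      define n where "n = i + Suc t"
      have "coeff (D * S) n = (\<Sum>k\<le>n. coeff D k * coeff S (n - k))"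
        by (rule coeff_mult)
      also have "\<dots> = coeff D i * b + (\<Sum>k\<in>{..n}-{i}. coeff D k * coeff S (n - k))"
        by (subst sum.remove[of _ i]) (auto simp: n_def b_def)
      finally have eq: "coeff D i * b * y =
          coeff (D * S) n * y - (\<Sum>k\<in>{..n}-{i}. coeff D k * coeff S (n - k) * y)"
        by (simp add: algebra_simps sum_distrib_left)
      have "coeff D k * coeff S (n - k) * y \<in> (?T ^^ Suc t) C" if k: "k \<in> {..n} - {i}" for k
      proof (cases "k < i")
        case True
        then have "coeff S (n - k) = 0"
          using Suc.prems(3) by (intro coeff_eq_0) (simp add: n_def)
        then show ?thesis using idTC[of "Suc t"] by (simp add: ideal_set_def)
      next
        case ki: False
        then have "k > i" using k by auto
        show ?thesis
        proof (cases "k \<le> degree D")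
          case False
          then show ?thesis using idTC[of "Suc t"] by (simp add: coeff_eq_0 ideal_set_def)
        next
          case kD: True
          have "n - k \<noteq> Suc t" using \<open>k > i\<close> by (simp add: n_def)
          with low[OF this less.prems] obtain u w where
            uw: "coeff S (n - k) * y = u + b * w" "u \<in> (?T ^^ t) C" "w \<in> (?T ^^ Suc t) UNIV"
            by blast
          have "coeff D k * u \<in> (?T ^^ Suc t) C"
            using coeff_content_mult[OF idTC uw(2)] by simp
          moreover have "coeff D k * b * w \<in> (?T ^^ Suc t) C"
            using \<open>k > i\<close> kD uw(3) by (intro less.hyps) auto
          ultimately have "coeff D k * u + coeff D k * b * w \<in> (?T ^^ Suc t) C"
            using idTC[of "Suc t"] unfolding ideal_set_def by blast
          moreover have "coeff D k * coeff S (n - k) * y = coeff D k * u + coeff D k * b * w"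
            by (simp only: mult.assoc uw(1) distrib_left)
          ultimately show ?thesis by simp
        qed
      qed
      then have "(\<Sum>k\<in>{..n}-{i}. coeff D k * coeff S (n - k) * y) \<in> (?T ^^ Suc t) C"
        by (intro ideal_set_sum idTC)
      moreover have "coeff (D * S) n * y \<in> (?T ^^ Suc t) C"
        using Suc.prems(1,2) less.prems by (intro mult_content_mult_funpow)
      ultimately show ?thesis unfolding eq by (intro ideal_set_diff idTC)
    qed
  qed
  from Suc.prems(4) obtain z where z: "x = (\<Sum>i\<le>degree D. coeff D i * z i)"
    "\<And>i. z i \<in> (?T ^^ Suc t) UNIV"
    by (auto elim: content_multE)
  have "coeff D i * (coeff S j * z i) \<in> (?T ^^ Suc t) C" for i
  proof (cases "j = Suc t")
    case True
    then show ?thesis using top[OF z(2), of i i] by (simp add: b_def mult.assoc)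
  next
    case False
    with low[OF this z(2)] obtain u w where
      uw: "coeff S j * z i = u + b * w" "u \<in> (?T ^^ t) C" "w \<in> (?T ^^ Suc t) UNIV"
      by blast
    have "coeff D i * u \<in> (?T ^^ Suc t) C"
      using coeff_content_mult[OF idTC uw(2)] by simp
    then have "coeff D i * u + coeff D i * b * w \<in> (?T ^^ Suc t) C"
      using top[OF uw(3), of i] idTC[of "Suc t"] unfolding ideal_set_def by blast
    moreover have "coeff D i * (coeff S j * z i) = coeff D i * u + coeff D i * b * w"
      by (simp only: mult.assoc uw(1) distrib_left)
    ultimately show ?thesis by simp
  qed
  then have "(\<Sum>i\<le>degree D. coeff D i * (coeff S j * z i)) \<in> (?T ^^ Suc t) C"
    by (intro ideal_set_sum idTC)
  moreover have "(\<Sum>i\<le>degree D. coeff D i * (coeff S j * z i)) = coeff S j * x"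
    by (simp add: z sum_distrib_left mult_ac)
  ultimately show ?case by simp
qed

section \<open>Monic factors over completely integrally closed domains\<close>

lemma content_mult_funpow_scale:
  "(content_mult D ^^ n) {c * y |y. y \<in> X} \<subseteq> {c * y |y. y \<in> (content_mult D ^^ n) X}"
proof (induction n)
  case (Suc n)
  show ?case
  proof
    fix z assume "z \<in> (content_mult D ^^ Suc n) {c * y |y. y \<in> X}"
    then obtain x where x: "z = (\<Sum>i\<le>degree D. coeff D i * x i)"
      "\<And>i. x i \<in> (content_mult D ^^ n) {c * y |y. y \<in> X}"
      by (auto elim: content_multE)
    with Suc.IH have "\<forall>i. \<exists>y. x i = c * y \<and> y \<in> (content_mult D ^^ n) X" by blast
    then obtain y where y: "\<And>i. x i = c * y i" "\<And>i. y i \<in> (content_mult D ^^ n) X" by metis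
    have "z = c * (\<Sum>i\<le>degree D. coeff D i * y i)"
      by (simp add: x(1) y(1) sum_distrib_left mult_ac)
    then show "z \<in> {c * y |y. y \<in> (content_mult D ^^ Suc n) X}"
      using content_multI[of y "(content_mult D ^^ n) X" D] y(2) by auto
  qed
qed simp

lemma coeff_power_content_mult: "coeff D i ^ n \<in> (content_mult D ^^ n) UNIV"
  by (induction n) (auto intro: coeff_content_mult ideal_set_funpow ideal_set_UNIV)

text \<open>The Laurent polynomial ring is not an instance of class \<open>idom\<close>, since \<open>int ^ 'd\<close> carries
  no linear order; hence the explicit hypotheses.\<close>

definition domain_ring :: "'a::comm_ring_1 itself \<Rightarrow> bool" where
  "domain_ring _ \<longleftrightarrow> (\<forall>a b::'a. a * b = 0 \<longrightarrow> a = 0 \<or> b = 0)"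

text \<open>Stated by divisibility, without a fraction field: if all powers of p/q have the common
  denominator r, then p/q lies in the ring.\<close>

definition completely_integrally_closed :: "'a::comm_ring_1 itself \<Rightarrow> bool" where
  "completely_integrally_closed _ \<longleftrightarrow>
     (\<forall>p q r::'a. q \<noteq> 0 \<longrightarrow> r \<noteq> 0 \<longrightarrow> (\<forall>n. q ^ n dvd r * p ^ n) \<longrightarrow> q dvd p)"

lemma domain_ringD: "domain_ring TYPE('a::comm_ring_1) \<Longrightarrow> a * b = 0 \<Longrightarrow> a = 0 \<or> b = (0::'a)"
  by (simp add: domain_ring_def)

lemma domain_ring_cancel:
  "domain_ring TYPE('a::comm_ring_1) \<Longrightarrow> c * a = c * b \<Longrightarrow> c \<noteq> 0 \<Longrightarrow> a = (b::'a)"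
  using domain_ringD[of c "a - b"] by (simp add: right_diff_distrib)

lemma domain_ring_power:
  assumes "domain_ring TYPE('a::comm_ring_1)" "(a::'a) \<noteq> 0"
  shows "a ^ n \<noteq> 0"
proof (induction n)
  case 0
  show ?case by simp
next
  case (Suc n)
  then show ?case using domain_ringD[OF assms(1), of a "a ^ n"] assms(2) by auto
qed

lemma domain_ring_degree_mult:
  fixes X Y :: "'a::comm_ring_1 poly"
  assumes "domain_ring TYPE('a)" "X \<noteq> 0" "Y \<noteq> 0"
  shows "degree (X * Y) = degree X + degree Y"
proof (rule antisym[OF degree_mult_le])
  have "coeff (X * Y) (degree X + degree Y) \<noteq> 0"
    using domain_ringD[OF assms(1), of "lead_coeff X" "lead_coeff Y"] assms(2,3)
    by (auto simp: coeff_mult_degree_sum)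
  then show "degree X + degree Y \<le> degree (X * Y)" by (rule le_degree)
qed

text \<open>A substitute for the Gauss lemma. With l and b the leading coefficients of
  \<open>D\<close> and \<open>S\<close>, the constant c is l b times a unit. Dedekind-Mertens for
  the principal ideal of c then makes every quotient of a coefficient of \<open>D\<close> by l
  almost integral.\<close>

lemma lead_coeff_dvd_coeff:
  fixes D S F :: "'a::comm_ring_1 poly"
  assumes dom: "domain_ring TYPE('a)" and cic: "completely_integrally_closed TYPE('a)"
    and eq: "D * S = smult c F" and c: "c \<noteq> 0" and u: "lead_coeff F * u = 1"
  shows "degree D + degree S = degree F" "lead_coeff D * lead_coeff S = c * lead_coeff F"
    "D \<noteq> 0" "S \<noteq> 0" "lead_coeff D dvd coeff D i"
proof -
  have cF: "c * lead_coeff F \<noteq> 0"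
    using c u by (metis mult.assoc mult.right_neutral mult_zero_left)
  then have cF': "coeff (smult c F) (degree F) \<noteq> 0" by simp
  then have degF: "degree (smult c F) = degree F"
    by (metis antisym degree_smult_le le_degree)
  have "smult c F \<noteq> 0" using cF' by (metis coeff_0)
  then show D0: "D \<noteq> 0" and S0: "S \<noteq> 0" using eq by auto
  show deg: "degree D + degree S = degree F"
    using domain_ring_degree_mult[OF dom D0 S0] degF eq by simp
  show lc: "lead_coeff D * lead_coeff S = c * lead_coeff F"
    using coeff_mult_degree_sum[of D S] by (simp add: deg eq)
  define s where "s = degree S"
  define l b where "l = lead_coeff D" and "b = lead_coeff S"
  have b0: "b \<noteq> 0" and l0: "l \<noteq> 0" using D0 S0 by (auto simp: b_def l_def)
  have c_eq: "c = l * b * u"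
    using lc u unfolding l_def b_def by (metis mult.assoc mult.right_neutral)
  let ?J = "\<lambda>k. (content_mult D ^^ k) UNIV"
  have J: "ideal_set (?J k)" for k by (intro ideal_set_funpow ideal_set_UNIV)
  \<comment> \<open>Cancelling b turns Dedekind-Mertens into the inclusion of c(D)^(s+1) in l
    c(D)^s; iterated below, every further factor c(D) is traded for a factor l.\<close>
  have step: "\<exists>y\<in>?J s. x = l * y" if x: "x \<in> ?J (Suc s)" for x
  proof -
    have "ideal_set {c * y |y. y \<in> UNIV}"
      unfolding ideal_set_def
    proof (intro conjI ballI allI)
      show "0 \<in> {c * y |y. y \<in> UNIV}" by (auto intro: exI[of _ 0])
    next
      fix x y assume "x \<in> {c * y |y. y \<in> UNIV}" "y \<in> {c * y |y. y \<in> UNIV}"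
      then show "x + y \<in> {c * y |y. y \<in> UNIV}" by (auto simp flip: distrib_left)
    next
      fix r x assume "x \<in> {c * y |y. y \<in> UNIV}"
      then obtain y where "x = c * y" by auto
      then have "r * x = c * (r * y)" by (simp add: mult_ac)
      then show "r * x \<in> {c * y |y. y \<in> UNIV}" by blast
    qed
    moreover have "coeff (D * S) k \<in> {c * y |y. y \<in> UNIV}" for k by (auto simp: eq)
    ultimately have "coeff S s * x \<in> (content_mult D ^^ s) {c * y |y. y \<in> UNIV}"
      using x by (intro dedekind_mertens) (auto simp: s_def)
    then obtain y where y: "b * x = c * y" "y \<in> ?J s"
      using content_mult_funpow_scale[of s D c UNIV] by (auto simp: s_def b_def)
    have "b * x = b * (l * (u * y))" by (simp add: y c_eq mult_ac)
    then have "x = l * (u * y)" using domain_ring_cancel[OF dom _ b0] by blast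
    moreover have "u * y \<in> ?J s" using J[of s] y(2) by (auto simp: ideal_set_def)
    ultimately show ?thesis by blast
  qed
  have iter: "\<exists>y\<in>?J s. x = l ^ n * y" if "x \<in> ?J (s + n)" for x n
    using that
  proof (induction n arbitrary: x)
    case 0
    then show ?case by auto
  next
    case (Suc n)
    then obtain z where z: "x = (\<Sum>i\<le>degree D. coeff D i * z i)" "\<And>i. z i \<in> ?J (s + n)"
      by (auto elim: content_multE)
    with Suc.IH have "\<forall>i. \<exists>y. z i = l ^ n * y \<and> y \<in> ?J s" by blast
    then obtain y where y: "\<And>i. z i = l ^ n * y i" "\<And>i. y i \<in> ?J s" by metis
    have "(\<Sum>i\<le>degree D. coeff D i * y i) \<in> ?J (Suc s)"
      using content_multI[OF y(2)] by simp
    with step obtain w where w: "w \<in> ?J s" "(\<Sum>i\<le>degree D. coeff D i * y i) = l * w" by blast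
    have "x = l ^ n * (\<Sum>i\<le>degree D. coeff D i * y i)"
      by (simp add: z(1) y(1) sum_distrib_left mult_ac)
    then have "x = l ^ Suc n * w" unfolding w(2) by (simp add: mult_ac)
    then show ?case using w(1) by blast
  qed
  \<comment> \<open>The fixed power \<open>coeff D i ^ s\<close> is the common denominator demanded
    by complete integral closedness.\<close>
  have "l ^ n dvd coeff D i ^ s * coeff D i ^ n" for n
    using iter[OF coeff_power_content_mult, of i n] by (auto simp: power_add)
  moreover have "coeff D i ^ s \<noteq> 0" if "coeff D i \<noteq> 0"
    using domain_ring_power[OF dom that] .
  ultimately have "l dvd coeff D i"
    using cic l0 unfolding completely_integrally_closed_def by (metis dvd_0_right)
  then show "lead_coeff D dvd coeff D i" by (simp add: l_def)
qed

lemma normalize_by_lead_coeff: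
  fixes D :: "'a::comm_ring_1 poly"
  assumes dom: "domain_ring TYPE('a)" and "D \<noteq> 0" and "\<And>i. lead_coeff D dvd coeff D i"
  obtains D1 where "D = smult (lead_coeff D) D1" "degree D1 = degree D" "lead_coeff D1 = 1"
proof -
  define l where "l = lead_coeff D"
  have l0: "l \<noteq> 0" using assms(2) by (simp add: l_def)
  have "\<forall>i. \<exists>k. coeff D i = l * k"
    using assms(3) unfolding l_def[symmetric] dvd_def by blast
  from choice[OF this] obtain g where g: "\<And>i. coeff D i = l * g i" by blast
  define D1 where "D1 = (\<Sum>i\<le>degree D. monom (g i) i)"
  have D1_hi: "coeff D1 i = 0" if "i > degree D" for i
    using that by (simp add: D1_def coeff_sum)
  have D1_lo: "coeff D1 i = g i" if "i \<le> degree D" for i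
    using that by (simp add: D1_def coeff_sum)
  have co: "coeff D i = l * coeff D1 i" for i
    using g[of i] by (cases "i \<le> degree D") (simp_all add: D1_lo D1_hi coeff_eq_0)
  have "l * coeff D1 (degree D) = l * 1" using co[of "degree D"] by (simp add: l_def)
  then have 1: "coeff D1 (degree D) = 1" using domain_ring_cancel[OF dom _ l0] by blast
  then have "coeff D1 (degree D) \<noteq> 0" using co[of "degree D"] l0 by (auto simp: l_def)
  then have "degree D \<le> degree D1" by (rule le_degree)
  moreover have "degree D1 \<le> degree D" using D1_hi by (intro degree_le) auto
  ultimately have deg: "degree D1 = degree D" by simp
  have "D = smult l D1" using co by (intro poly_eqI) simp
  then show ?thesis using deg 1 unfolding l_def by (intro that[of D1]) simp_all
qed

text \<open>The divisibility result applies to both factors, as the hypothesis is symmetric in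
  \<open>D\<close> and \<open>S\<close>. The product of their leading coefficients is c times that
  of \<open>F\<close>, so c cancels.\<close>

lemma monic_factorization:
  fixes D S F :: "'a::comm_ring_1 poly"
  assumes dom: "domain_ring TYPE('a)" and cic: "completely_integrally_closed TYPE('a)"
    and eq: "D * S = smult c F" and c: "c \<noteq> 0" and u: "lead_coeff F * u = 1"
  obtains D1 S1 where "D = smult (lead_coeff D) D1" "degree D1 = degree D" "lead_coeff D1 = 1"
    "degree S1 = degree F - degree D" "degree D \<le> degree F" "lead_coeff S1 = 1"
    "F = smult (lead_coeff F) (D1 * S1)"
proof -
  note D = lead_coeff_dvd_coeff[OF assms]
  have eq': "S * D = smult c F" using eq by (simp add: mult.commute)
  note S = lead_coeff_dvd_coeff[OF dom cic eq' c u]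
  obtain D1 where D1: "D = smult (lead_coeff D) D1" "degree D1 = degree D" "lead_coeff D1 = 1"
    using normalize_by_lead_coeff[OF dom D(3,5)] by blast
  obtain S1 where S1: "S = smult (lead_coeff S) S1" "degree S1 = degree S" "lead_coeff S1 = 1"
    using normalize_by_lead_coeff[OF dom S(3,5)] by blast
  have "smult c F = smult (lead_coeff D * lead_coeff S) (D1 * S1)"
    using eq D1(1) S1(1) by (metis mult_smult_left mult_smult_right smult_smult)
  then have "smult c F = smult c (smult (lead_coeff F) (D1 * S1))" by (simp add: D(2))
  then have "coeff F n = coeff (smult (lead_coeff F) (D1 * S1)) n" for n
    using domain_ring_cancel[OF dom _ c] by (metis coeff_smult)
  then have "F = smult (lead_coeff F) (D1 * S1)" by (rule poly_eqI)
  moreover have "degree S1 = degree F - degree D" "degree D \<le> degree F" using S1(2) D(1) by simp_all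
  ultimately show ?thesis using D1 S1(3) by (intro that[of D1 S1])
qed

text \<open>An ideal element of least degree replaces the gcd. If it is not constant in the
  polynomial variable, its monic associate divides both \<open>F\<close> and \<open>G\<close>, and
  irreducibility leaves no room for a cofactor.\<close>

theorem irreducible_eq_or_comaximal_const:
  fixes F G :: "'a::comm_ring_1 poly"
  assumes dom: "domain_ring TYPE('a)" and cic: "completely_integrally_closed TYPE('a)"
    and irr: "irreducible F" and deg: "degree G = degree F"
    and lc: "lead_coeff G = lead_coeff F" and u: "lead_coeff F * u = 1"
  shows "F = G \<or> (\<exists>X Y c. c \<noteq> 0 \<and> X * F + Y * G = [:c:])"
proof -
  define I where "I = {X * F + Y * G |X Y. True}"
  have "F = 1 * F + 0 * G" by simp
  then have FI: "F \<in> I" unfolding I_def by blast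
  have "G = 0 * F + 1 * G" by simp
  then have GI: "G \<in> I" unfolding I_def by blast
  have F0: "F \<noteq> 0" using irr by auto
  obtain D where D: "D \<in> I" "D \<noteq> 0" "\<And>H. H \<in> I \<Longrightarrow> H \<noteq> 0 \<Longrightarrow> degree D \<le> degree H"
    using ex_has_least_nat[of "\<lambda>D. D \<in> I \<and> D \<noteq> 0" F degree] FI F0 by blast
  \<comment> \<open>The pseudo-remainder stays in the ideal and has smaller degree than
    \<open>D\<close>, so minimality makes it 0.\<close>
  have div: "\<exists>c S. c \<noteq> 0 \<and> D * S = smult c H" if H: "H \<in> I" for H
  proof -
    obtain q r where qr: "pseudo_divmod H D = (q, r)" by fastforce
    define c where "c = lead_coeff D ^ (Suc (degree H) - degree D)"
    have eq: "smult c H = D * q + r" and r: "r = 0 \<or> degree r < degree D"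
      using pseudo_divmod[OF D(2) qr] by (auto simp: c_def)
    obtain X Y X' Y' where XY: "H = X * F + Y * G" "D = X' * F + Y' * G"
      using H D(1) by (auto simp: I_def)
    have "r = [:c:] * H - q * D" using eq by (simp add: mult.commute)
    also have "\<dots> = ([:c:] * X - q * X') * F + ([:c:] * Y - q * Y') * G"
      unfolding XY by (simp only: algebra_simps)
    finally have "r \<in> I" by (auto simp: I_def)
    then have "r = 0" using D(3) r by force
    moreover have "c \<noteq> 0" unfolding c_def using D(2) by (intro domain_ring_power[OF dom]) auto
    moreover have "D * q = smult c H" using eq \<open>r = 0\<close> by simp
    ultimately show ?thesis by blast
  qed
  show ?thesis
  proof (cases "degree D = 0")
    case True
    then obtain c where "D = [:c:]" by (metis degree_eq_zeroE)
    then show ?thesis using D(1,2) by (force simp: I_def)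
  next
    case False
    obtain c S where cS: "c \<noteq> 0" "D * S = smult c F" using div[OF FI] by blast
    obtain D1 S1 where F: "D = smult (lead_coeff D) D1" "degree D1 = degree D" "lead_coeff D1 = 1"
      "degree S1 = degree F - degree D" "degree D \<le> degree F" "lead_coeff S1 = 1"
      "F = smult (lead_coeff F) (D1 * S1)"
      using monic_factorization[OF dom cic cS(2,1) u] by blast
    obtain c' S' where cS': "c' \<noteq> 0" "D * S' = smult c' G" using div[OF GI] by blast
    have u': "lead_coeff G * u = 1" using u lc by simp
    obtain D2 S2 where G: "D = smult (lead_coeff D) D2" "degree D2 = degree D" "lead_coeff D2 = 1"
      "degree S2 = degree G - degree D" "degree D \<le> degree G" "lead_coeff S2 = 1"
      "G = smult (lead_coeff G) (D2 * S2)"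
      using monic_factorization[OF dom cic cS'(2,1) u'] by blast
    \<comment> \<open>Both factorizations normalize the same \<open>D\<close> by the same leading
      coefficient, so the monic factors agree.\<close>
    have "coeff D1 n = coeff D2 n" for n
      using domain_ring_cancel[OF dom, of "lead_coeff D" "coeff D1 n" "coeff D2 n"] F(1) G(1) D(2)
      by (metis coeff_smult leading_coeff_0_iff)
    then have D12: "D1 = D2" by (rule poly_eqI)
    have unit_deg: "degree X = 0" if "X dvd 1" for X :: "'a poly"
    proof -
      from that obtain Y where Y: "1 = X * Y" by (elim dvdE)
      then have "X \<noteq> 0" "Y \<noteq> 0" by auto
      then show ?thesis using domain_ring_degree_mult[OF dom, of X Y] Y by simp
    qed
    have const_1: "X = 1" if "degree X = 0" "lead_coeff X = 1" for X :: "'a poly"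
      using that by (auto elim!: degree_eq_zeroE simp: one_pCons)
    \<comment> \<open>The unit \<open>lead_coeff F\<close> is absorbed into the first factor. That
      factor has positive degree and is not a unit, so irreducibility makes the monic
      \<open>S1\<close> a unit, hence 1.\<close>
    have "F = smult (lead_coeff F) D1 * S1" using F(7) by simp
    moreover have "degree (smult (lead_coeff F) D1) \<noteq> 0"
    proof -
      have "coeff (smult (lead_coeff F) D1) (degree D1) \<noteq> 0" using F(3) F0 by simp
      then have "degree D1 \<le> degree (smult (lead_coeff F) D1)" by (rule le_degree)
      then show ?thesis using False F(2) by simp
    qed
    ultimately have "S1 dvd 1"
      using irr unit_deg[of "smult (lead_coeff F) D1"] unfolding irreducible_def by metis
    then have "degree S1 = 0" by (rule unit_deg)
    then have S1: "S1 = 1" using const_1 F(6) by blast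
    have "degree S2 = 0" using G(4) F(4,5) \<open>degree S1 = 0\<close> deg by simp
    then have "S2 = 1" using const_1 G(6) by blast
    then show ?thesis using F(7) G(7) S1 D12 lc by simp
  qed
qed

section \<open>Laurent polynomials\<close>

abbreviation "lookup \<equiv> Poly_Mapping.lookup"
abbreviation "keys \<equiv> Poly_Mapping.keys"

section \<open>Integer weights on exponent vectors\<close>

definition weight :: "int ^ 'd \<Rightarrow> int ^ 'd \<Rightarrow> int" where
  "weight v m = (\<Sum>j\<in>UNIV. v $ j * m $ j)"

lemma weight_add: "weight v (a + b) = weight v a + weight v b"
  by (simp add: weight_def distrib_left sum.distrib)

lemma weight_diff: "weight v (a - b) = weight v a - weight v b"
  by (simp add: weight_def right_diff_distrib sum_subtractf)

text \<open>The weight is taken as \<open>(1, t, t^2, \<dots>)\<close> with \<open>t\<close> avoiding the roots of finitely many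
  polynomials.\<close>

lemma separating_weight:
  fixes T :: "(int ^ 'd::finite) set"
  assumes "finite T"
  obtains v :: "int ^ 'd" where "inj_on (weight v) T"
proof -
  obtain f :: "'d \<Rightarrow> nat" where f: "inj f"
    using finite_imp_inj_to_nat_seg[of "UNIV :: 'd set"] by auto
  \<comment> \<open>The coordinates of d become coefficients at distinct exponents, so
    \<open>P d\<close> is nonzero for nonzero d, and its value at t is the weight of d for the
    vector of powers \<open>t ^ f j\<close>.\<close>
  define P where "P d = (\<Sum>j\<in>UNIV. monom (d $ j) (f j))" for d :: "int ^ 'd"
  have coP: "coeff (P d) (f j) = d $ j" for d j
  proof -
    have "coeff (P d) (f j) = (\<Sum>i\<in>UNIV. if i = j then d $ i else 0)"
      unfolding P_def coeff_sum coeff_monom using f by (intro sum.cong) (auto dest: injD)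
    then show ?thesis by simp
  qed
  have P0: "P d \<noteq> 0" if "d \<noteq> 0" for d
    using that coP[of d] by (metis coeff_0 vec_eq_iff zero_index)
  define X where "X = (\<Union>(a, b)\<in>{(a, b). a \<in> T \<and> b \<in> T \<and> a \<noteq> b}. {x. poly (P (a - b)) x = 0})"
  have "finite {(a, b). a \<in> T \<and> b \<in> T \<and> a \<noteq> b}"
    by (rule finite_subset[of _ "T \<times> T"]) (use assms in auto)
  then have "finite X"
    unfolding X_def by (auto intro!: poly_roots_finite P0)
  then obtain t where t: "t \<notin> X" using ex_new_if_finite[OF infinite_UNIV_int] by blast
  define v :: "int ^ 'd" where "v = (\<chi> j. t ^ f j)"
  have "poly (P d) t = weight v d" for d
    by (simp add: P_def weight_def v_def poly_sum poly_monom mult.commute)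
  then have "inj_on (weight v) T"
    using t unfolding inj_on_def X_def by (auto simp: weight_diff)
  then show ?thesis by (rule that)
qed

lemma lookup_mult_keys:
  fixes p q :: "'a::ab_group_add \<Rightarrow>\<^sub>0 'b::semiring_0"
  shows "lookup (p * q) k = (\<Sum>l\<in>keys p. lookup p l * lookup q (k - l))"
proof -
  have "(\<Sum>x. lookup q x when k = l + x) = lookup q (k - l)" for l
  proof -
    have "k = l + x \<longleftrightarrow> x = k - l" for x by (auto simp: algebra_simps)
    then show ?thesis by simp
  qed
  then have "lookup (p * q) k = (\<Sum>l. lookup p l * lookup q (k - l))"
    by (simp add: lookup_mult)
  also have "\<dots> = (\<Sum>l\<in>keys p. lookup p l * lookup q (k - l))"
  proof (rule Sum_any.expand_superset)
    show "{a. lookup p a * lookup q (k - a) \<noteq> 0} \<subseteq> keys p"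
      by (auto simp: in_keys_iff)
  qed simp
  finally show ?thesis .
qed

text \<open>In any other pair of exponents with sum a + b, the one from \<open>q\<close> is lighter
  than a, so the other is heavier than b and lies outside \<open>keys u\<close>. Strictness is asked
  of \<open>q\<close> alone, so a weight separating the monomials of \<open>q\<close> works against
  every \<open>u\<close>.\<close>

lemma lookup_mult_extreme:
  fixes q u :: "'a::ab_group_add \<Rightarrow>\<^sub>0 'b::semiring_0" and \<phi> :: "'a \<Rightarrow> int"
  assumes add: "\<And>a b. \<phi> (a + b) = \<phi> a + \<phi> b"
    and q: "\<And>m. m \<in> keys q \<Longrightarrow> m \<noteq> a \<Longrightarrow> \<phi> m < \<phi> a"
    and u: "\<And>m. m \<in> keys u \<Longrightarrow> \<phi> m \<le> \<phi> b"
  shows "lookup (q * u) (a + b) = lookup q a * lookup u b"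
proof -
  have 0: "lookup q l * lookup u (a + b - l) = 0" if "l \<in> keys q" "l \<noteq> a" for l
  proof -
    have "\<phi> (a + b - l) + \<phi> l = \<phi> a + \<phi> b"
      using add[of "a + b - l" l] add[of a b] by simp
    then have "a + b - l \<notin> keys u" using u[of "a + b - l"] q[OF that] by auto
    then show ?thesis by (simp add: in_keys_iff)
  qed
  have "lookup (q * u) (a + b) = (\<Sum>l\<in>keys q. if l = a then lookup q a * lookup u b else 0)"
    unfolding lookup_mult_keys using 0 by (intro sum.cong) auto
  also have "\<dots> = lookup q a * lookup u b"
    by (simp add: in_keys_iff)
  finally show ?thesis .
qed

section \<open>Top weights of products\<close>

definition top_weight :: "('a \<Rightarrow> int) \<Rightarrow> ('a \<Rightarrow>\<^sub>0 'b::zero) \<Rightarrow> int" where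
  "top_weight \<phi> p = Max (\<phi> ` keys p)"

lemma top_weight_ge: "m \<in> keys p \<Longrightarrow> \<phi> m \<le> top_weight \<phi> p"
  by (simp add: top_weight_def)

lemma top_weight_attained:
  assumes "p \<noteq> 0"
  obtains m where "m \<in> keys p" "\<phi> m = top_weight \<phi> p"
proof -
  have "keys p \<noteq> {}" using assms by (metis in_keys_iff empty_iff lookup_zero poly_mapping_eqI)
  then have "Max (\<phi> ` keys p) \<in> \<phi> ` keys p" by (intro Max_in) auto
  then show ?thesis using that by (auto simp: top_weight_def)
qed

lemma top_weight_mult_le:
  fixes p q :: "'a::ab_group_add \<Rightarrow>\<^sub>0 'b::semiring_0"
  assumes "\<And>a b. \<phi> (a + b) = \<phi> a + \<phi> b" "p * q \<noteq> 0"
  shows "top_weight \<phi> (p * q) \<le> top_weight \<phi> p + top_weight \<phi> q"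
proof -
  obtain m where m: "m \<in> keys (p * q)" "\<phi> m = top_weight \<phi> (p * q)"
    using top_weight_attained[OF assms(2)] by blast
  then obtain a b where "m = a + b" "a \<in> keys p" "b \<in> keys q" using keys_mult[of p q] by blast
  then show ?thesis
    using m(2) assms(1) top_weight_ge[of a p \<phi>] top_weight_ge[of b q \<phi>] by simp
qed

lemma top_weight_mult_inj:
  fixes q u :: "'a::ab_group_add \<Rightarrow>\<^sub>0 'b::semiring_no_zero_divisors"
  assumes add: "\<And>a b. \<phi> (a + b) = \<phi> a + \<phi> b" and inj: "inj_on \<phi> (keys q)"
    and "q \<noteq> 0" "u \<noteq> 0"
  shows "q * u \<noteq> 0" "top_weight \<phi> (q * u) = top_weight \<phi> q + top_weight \<phi> u"
proof -
  obtain a where a: "a \<in> keys q" "\<phi> a = top_weight \<phi> q" using top_weight_attained[OF assms(3)] by blast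
  obtain b where b: "b \<in> keys u" "\<phi> b = top_weight \<phi> u" using top_weight_attained[OF assms(4)] by blast
  have "lookup (q * u) (a + b) = lookup q a * lookup u b"
  proof (rule lookup_mult_extreme[of \<phi>, OF add])
    show "\<phi> m < \<phi> a" if "m \<in> keys q" "m \<noteq> a" for m
      using top_weight_ge[OF that(1), of \<phi>] inj_onD[OF inj _ that(1) a(1)] that(2) a(2) by fastforce
    show "\<phi> m \<le> \<phi> b" if "m \<in> keys u" for m
      using top_weight_ge[OF that, of \<phi>] b(2) by simp
  qed
  then have k: "a + b \<in> keys (q * u)" using a(1) b(1) by (simp add: in_keys_iff)
  then show *: "q * u \<noteq> 0" by auto
  show "top_weight \<phi> (q * u) = top_weight \<phi> q + top_weight \<phi> u"
    using top_weight_mult_le[OF add *] top_weight_ge[OF k, of \<phi>] add[of a b] a b by simp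
qed

text \<open>A weight separating the monomials of one factor gives it a unique top monomial, whose
  product with a top monomial of the other factor cannot cancel.\<close>

lemma domain_ring_laurent: "domain_ring TYPE('d::finite laurent)"
  unfolding domain_ring_def
proof (intro allI impI, rule ccontr)
  fix a b :: "'d laurent" assume "a * b = 0" "\<not> (a = 0 \<or> b = 0)"
  moreover obtain v :: "int ^ 'd" where "inj_on (weight v) (keys a)"
    using separating_weight[OF finite_keys[of a]] by blast
  ultimately show False using top_weight_mult_inj(1)[of "weight v" a b] by (simp add: weight_add)
qed

text \<open>By the binomial theorem, almost integrality of p/q passes to p/q - h. This keeps the
  hypothesis alive through a division step.\<close>

lemma dvd_power_diff_mult:
  fixes p q r h :: "'a::comm_ring_1"
  assumes "\<And>n. q ^ n dvd r * p ^ n"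
  shows "q ^ n dvd r * (p - h * q) ^ n"
proof -
  have "r * (p - h * q) ^ n = r * (p + (- h) * q) ^ n" by simp
  also have "\<dots> = (\<Sum>k\<le>n. (r * p ^ k) * (of_nat (n choose k) * ((- h) * q) ^ (n - k)))"
    unfolding binomial_ring sum_distrib_left by (intro sum.cong) (simp_all add: mult_ac)
  also have "q ^ n dvd \<dots>"
  proof (rule dvd_sum)
    fix k assume "k \<in> {..n}"
    then have "q ^ n = q ^ k * q ^ (n - k)" by (simp flip: power_add)
    moreover have "q ^ (n - k) dvd of_nat (n choose k) * ((- h) * q) ^ (n - k)"
      unfolding power_mult_distrib by (intro dvd_mult dvd_refl)
    ultimately show "q ^ n dvd (r * p ^ k) * (of_nat (n choose k) * ((- h) * q) ^ (n - k))"
      using assms[of k] by (simp only: mult_dvd_mono)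
  qed
  finally show ?thesis .
qed

text \<open>The factors \<open>q\<close> are multiplied on one at a time, because \<phi> separates
  the monomials of \<open>q\<close> but not necessarily those of its powers.\<close>

lemma top_weight_power_mult_inj:
  fixes q s :: "'d::finite laurent"
  assumes add: "\<And>a b. \<phi> (a + b) = \<phi> a + \<phi> b" and inj: "inj_on \<phi> (keys q)"
    and "q \<noteq> 0" "s \<noteq> 0"
  shows "top_weight \<phi> (q ^ n * s) = int n * top_weight \<phi> q + top_weight \<phi> s"
proof (induction n)
  case (Suc n)
  have "q ^ n * s \<noteq> 0"
    using domain_ringD[OF domain_ring_laurent, of "q ^ n" s]
      domain_ring_power[OF domain_ring_laurent assms(3)] assms(4) by blast
  then have "top_weight \<phi> (q * (q ^ n * s)) = top_weight \<phi> q + top_weight \<phi> (q ^ n * s)"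
    by (rule top_weight_mult_inj(2)[OF add inj assms(3)])
  then show ?case using Suc by (simp add: algebra_simps)
qed simp

lemma top_weight_power_mult_le:
  fixes p r :: "'d::finite laurent"
  assumes add: "\<And>a b. \<phi> (a + b) = \<phi> a + \<phi> b" and "p \<noteq> 0" "r \<noteq> 0"
  shows "top_weight \<phi> (r * p ^ n) \<le> top_weight \<phi> r + int n * top_weight \<phi> p"
proof (induction n)
  case (Suc n)
  have "p * (r * p ^ n) \<noteq> 0"
    using domain_ringD[OF domain_ring_laurent] domain_ring_power[OF domain_ring_laurent assms(2)]
      assms(2,3) by blast
  then have "top_weight \<phi> (p * (r * p ^ n)) \<le> top_weight \<phi> p + top_weight \<phi> (r * p ^ n)"
    by (intro top_weight_mult_le add)
  then show ?case using Suc by (simp add: algebra_simps)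
qed simp

text \<open>Laurent division of \<open>p\<close> by \<open>q\<close> with respect to a weight separating the monomials of \<open>q\<close>: the
  leading form of \<open>q\<close> is then a single term, that is, a unit. Each step lowers the width of \<open>p\<close>,
  and the divisibility hypothesis forces the width of \<open>p\<close> to be at least that of \<open>q\<close>, so that the
  division only stops at \<open>0\<close>.\<close>

lemma completely_integrally_closed_laurent:
  "completely_integrally_closed TYPE('d::finite laurent)"
  unfolding completely_integrally_closed_def
proof (intro allI impI)
  fix p q r :: "'d laurent"
  assume q0: "q \<noteq> 0" and r0: "r \<noteq> 0" and dvd: "\<forall>n. q ^ n dvd r * p ^ n"
  obtain v :: "int ^ 'd" where inj: "inj_on (weight v) (keys q)"
    using separating_weight[OF finite_keys[of q]] by blast
  define \<phi> where "\<phi> = weight v"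
  \<comment> \<open>The top weight for \<psi> is minus the lowest weight for \<phi>, so the width
    defined below is the spread between highest and lowest weight.\<close>
  define \<psi> where "\<psi> m = - \<phi> m" for m
  have \<phi>_add: "\<phi> (a + b) = \<phi> a + \<phi> b" for a b by (simp add: \<phi>_def weight_add)
  have \<psi>_add: "\<psi> (a + b) = \<psi> a + \<psi> b" for a b by (simp add: \<psi>_def \<phi>_add)
  have \<phi>_inj: "inj_on \<phi> (keys q)" using inj by (simp add: \<phi>_def)
  have \<psi>_inj: "inj_on \<psi> (keys q)" using \<phi>_inj by (simp add: \<psi>_def inj_on_def)
  define width where "width p = top_weight \<phi> p + top_weight \<psi> p" for p :: "'d laurent"
  have width_nonneg: "width p \<ge> 0" if p: "p \<noteq> 0" for p
  proof -
    obtain m where "m \<in> keys p" using top_weight_attained[OF p] by blast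
    then show ?thesis
      using top_weight_ge[of m p \<phi>] top_weight_ge[of m p \<psi>] by (simp add: width_def \<psi>_def)
  qed
  obtain a where a: "a \<in> keys q" "\<phi> a = top_weight \<phi> q"
    using top_weight_attained[OF q0] by blast
  \<comment> \<open>Comparing widths in \<open>r * p ^ n = q ^ n * s\<close> bounds n (width q -
    width p) by width r - width s; a gap of at least 1 is refuted by an n exceeding width r.\<close>
  have width_le: "width q \<le> width p" if dvd: "\<And>n. q ^ n dvd r * p ^ n" and p: "p \<noteq> 0" for p
  proof (rule ccontr)
    assume "\<not> width q \<le> width p"
    then have lt: "width p + 1 \<le> width q" by simp
    define n where "n = nat (width r) + 1"
    obtain s where s: "r * p ^ n = q ^ n * s" using dvd by (auto elim: dvdE)
    have "r * p ^ n \<noteq> 0"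
      using domain_ringD[OF domain_ring_laurent] domain_ring_power[OF domain_ring_laurent p] r0 by blast
    then have s0: "s \<noteq> 0" using s by auto
    have "int n * top_weight \<phi> q + top_weight \<phi> s \<le> top_weight \<phi> r + int n * top_weight \<phi> p"
      using top_weight_power_mult_inj[OF \<phi>_add \<phi>_inj q0 s0, of n]
        top_weight_power_mult_le[OF \<phi>_add p r0, of n] s by simp
    moreover have "int n * top_weight \<psi> q + top_weight \<psi> s \<le> top_weight \<psi> r + int n * top_weight \<psi> p"
      using top_weight_power_mult_inj[OF \<psi>_add \<psi>_inj q0 s0, of n]
        top_weight_power_mult_le[OF \<psi>_add p r0, of n] s by simp
    ultimately have "int n * width q + width s \<le> width r + int n * width p"
      by (simp add: width_def algebra_simps)
    moreover have "int n * (width p + 1) \<le> int n * width q"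
      using lt by (intro mult_left_mono) auto
    ultimately have "int n + width s \<le> width r" by (simp add: algebra_simps)
    then show False using width_nonneg[OF s0] width_nonneg[OF r0] by (simp add: n_def)
  qed
  have "q dvd p" if "\<And>n. q ^ n dvd r * p ^ n" for p
    using that
  proof (induction "nat (width p)" arbitrary: p rule: less_induct)
    case less
    show ?case
    proof (cases "p = 0")
      case False
      define c where "c = lookup q a"
      have c0: "c \<noteq> 0" using a(1) by (simp add: c_def in_keys_iff)
      \<comment> \<open>The part of \<open>p\<close> of top weight, possibly several monomials,
        divided by the single leading term of \<open>q\<close>, which has exponent a and coefficient
        c.\<close>
      define h where "h = (\<Sum>m | m \<in> keys p \<and> \<phi> m = top_weight \<phi> p. Poly_Mapping.single (m - a) (lookup p m / c))"
      have look_h: "lookup h l = (if \<phi> (l + a) = top_weight \<phi> p then lookup p (l + a) / c else 0)" for l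
      proof -
        have "lookup h l = (\<Sum>m | m \<in> keys p \<and> \<phi> m = top_weight \<phi> p.
            if m = l + a then lookup p m / c else 0)"
          unfolding h_def lookup_sum lookup_single
          by (intro sum.cong refl) (auto simp: when_def)
        then show ?thesis by (auto simp: in_keys_iff)
      qed
      have top_eq: "lookup (q * h) k = lookup p k" if k: "\<phi> k = top_weight \<phi> p" for k
      proof -
        have "lookup q l * lookup h (k - l) = (if l = a then lookup p k else 0)" if l: "l \<in> keys q" for l
        proof (cases "l = a")
          case True
          then show ?thesis using c0 k by (simp add: look_h c_def)
        next
          case False
          then have "\<phi> l \<noteq> \<phi> a" using inj_onD[OF \<phi>_inj _ l a(1)] by blast
          moreover have "\<phi> (k - l + a) = \<phi> k - \<phi> l + \<phi> a"
            using \<phi>_add[of "k - l" l] \<phi>_add[of "k - l" a] by simp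
          ultimately show ?thesis using False k by (simp add: look_h)
        qed
        then have "lookup (q * h) k = (\<Sum>l\<in>keys q. if l = a then lookup p k else 0)"
          unfolding lookup_mult_keys by (intro sum.cong) auto
        then show ?thesis using a(1) by simp
      qed
      \<comment> \<open>The lower end is the delicate one: \<open>q * h\<close> reaches down by the
        width of \<open>q\<close> from the top weight of \<open>p\<close>, and
        \<open>width_le\<close> keeps this above the lowest weight of \<open>p\<close>.\<close>
      have keys_qh: "\<phi> k \<le> top_weight \<phi> p \<and> \<psi> k \<le> top_weight \<psi> p" if k: "k \<in> keys (q * h)" for k
      proof -
        obtain m l where ml: "k = m + l" "m \<in> keys q" "l \<in> keys h" using k keys_mult[of q h] by blast
        have "\<phi> (l + a) = top_weight \<phi> p"
          using ml(3) look_h[of l] by (auto simp: in_keys_iff split: if_splits)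
        then have "\<phi> k = top_weight \<phi> p + \<phi> m - top_weight \<phi> q"
          using ml(1) a(2) \<phi>_add[of m l] \<phi>_add[of l a] by simp
        moreover have "\<phi> m \<le> top_weight \<phi> q" "\<psi> m \<le> top_weight \<psi> q"
          using ml(2) by (auto intro: top_weight_ge)
        moreover have "width q \<le> width p" using less.prems False by (rule width_le)
        ultimately show ?thesis by (simp add: width_def \<psi>_def)
      qed
      define p' where "p' = p - h * q"
      have look_p': "lookup p' k = lookup p k - lookup (q * h) k" for k
        by (simp add: p'_def lookup_minus mult.commute)
      have keys_p': "\<phi> k < top_weight \<phi> p \<and> \<psi> k \<le> top_weight \<psi> p" if k: "k \<in> keys p'" for k
      proof -
        have "k \<in> keys p \<or> k \<in> keys (q * h)" using k look_p'[of k] by (auto simp: in_keys_iff)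
        then have "\<phi> k \<le> top_weight \<phi> p \<and> \<psi> k \<le> top_weight \<psi> p"
          using keys_qh[of k] top_weight_ge[of k p \<phi>] top_weight_ge[of k p \<psi>] by blast
        moreover have "\<phi> k \<noteq> top_weight \<phi> p"
          using k look_p'[of k] top_eq[of k] by (auto simp: in_keys_iff)
        ultimately show ?thesis by simp
      qed
      have dvd': "q ^ n dvd r * p' ^ n" for n
        unfolding p'_def by (rule dvd_power_diff_mult) (rule less.prems)
      have "q dvd p'"
      proof (cases "p' = 0")
        case p'0: False
        obtain m1 where m1: "m1 \<in> keys p'" "\<phi> m1 = top_weight \<phi> p'"
          using top_weight_attained[OF p'0] by blast
        obtain m2 where m2: "m2 \<in> keys p'" "\<psi> m2 = top_weight \<psi> p'"
          using top_weight_attained[OF p'0] by blast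
        have "width p' < width p" using keys_p'[OF m1(1)] keys_p'[OF m2(1)] m1(2) m2(2)
          by (simp add: width_def)
        then have "nat (width p') < nat (width p)" using width_nonneg[OF p'0] by simp
        then show ?thesis using dvd' by (rule less.hyps)
      qed simp
      moreover have "p = p' + h * q" by (simp add: p'_def)
      ultimately show ?thesis by simp
    qed simp
  qed
  then show "q dvd p" using dvd by blast
qed

section \<open>Evaluation and characteristic polynomials\<close>

definition unital_ring_hom :: "('a::comm_ring_1 \<Rightarrow> 'b::comm_ring_1) \<Rightarrow> bool" where
  "unital_ring_hom h \<longleftrightarrow>
     h 0 = 0 \<and> h 1 = 1 \<and> (\<forall>x y. h (x + y) = h x + h y) \<and> (\<forall>x y. h (x * y) = h x * h y)"

lemma unital_ring_homD:
  assumes "unital_ring_hom h"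
  shows "h 0 = 0" "h 1 = 1" "h (x + y) = h x + h y" "h (x * y) = h x * h y"
  using assms by (auto simp: unital_ring_hom_def)

lemma unital_ring_hom_uminus:
  assumes "unital_ring_hom h"
  shows "h (- x) = - h x"
proof -
  have "h (- x) + h x = 0" using unital_ring_homD[OF assms] by (metis add.left_inverse)
  then show ?thesis by (simp add: eq_neg_iff_add_eq_0)
qed

lemma unital_ring_hom_sum: "unital_ring_hom h \<Longrightarrow> h (sum f S) = (\<Sum>x\<in>S. h (f x))"
  by (induction S rule: infinite_finite_induct) (auto simp: unital_ring_homD)

lemma unital_ring_hom_prod: "unital_ring_hom h \<Longrightarrow> h (prod f S) = (\<Prod>x\<in>S. h (f x))"
  by (induction S rule: infinite_finite_induct) (auto simp: unital_ring_homD)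

lemma unital_ring_hom_sign: "unital_ring_hom h \<Longrightarrow> h (of_int (sign p)) = of_int (sign p)"
  by (auto simp: sign_def unital_ring_homD unital_ring_hom_uminus)

lemma unital_ring_hom_det:
  fixes M :: "'a::comm_ring_1 ^ 'n ^ 'n"
  assumes "unital_ring_hom h"
  shows "h (det M) = det (\<chi> i j. h (M $ i $ j))"
  by (simp add: det_def unital_ring_hom_sum[OF assms] unital_ring_hom_prod[OF assms]
      unital_ring_homD(4)[OF assms] unital_ring_hom_sign[OF assms])

lemma unital_ring_hom_poly_eval:
  assumes h: "unital_ring_hom h"
  shows "unital_ring_hom (\<lambda>p. poly (map_poly h p) x)"
proof -
  note hD = unital_ring_homD[OF h]
  have "map_poly h (p + q) = map_poly h p + map_poly h q" for p q
    by (intro poly_eqI) (simp add: coeff_map_poly hD)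
  moreover have "map_poly h (p * q) = map_poly h p * map_poly h q" for p q
    by (intro poly_eqI) (simp add: coeff_map_poly hD coeff_mult unital_ring_hom_sum[OF h])
  ultimately show ?thesis by (simp add: unital_ring_hom_def hD)
qed

lemma poly_map_poly_pcompose_shift:
  assumes h: "unital_ring_hom h"
  shows "poly (map_poly h (pcompose p [:c, 1:])) x = poly (map_poly h p) (h c + x)"
proof (induction p)
  case (pCons a p)
  note hD = unital_ring_homD[OF h]
  note ED = unital_ring_homD[OF unital_ring_hom_poly_eval[OF h, of x]]
  show ?case
    unfolding pcompose_pCons ED pCons.IH by (simp add: map_poly_pCons hD)
qed simp

text \<open>A general homomorphism covers both uses: evaluation at a torus point for
  \<open>charP\<close>, and the identity for \<open>cpoly\<close>.\<close>

lemma poly_map_poly_charpoly: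
  fixes M :: "'a::comm_ring_1 ^ 'n ^ 'n"
  assumes h: "unital_ring_hom h"
  shows "poly (map_poly h (det (\<chi> i j. [:M $ i $ j:] - (if i = j then [:0, 1:] else 0)))) x =
    det (\<chi> i j. h (M $ i $ j) - (if i = j then x else 0))"
proof -
  let ?E = "\<lambda>p. poly (map_poly h p) x"
  note hD = unital_ring_homD[OF h]
  note E = unital_ring_hom_poly_eval[OF h, of x]
  have "?E ([:m:] - q) = h m - ?E q" for m q
    using unital_ring_homD(3)[OF E, of "[:m:]" "- q"] unital_ring_hom_uminus[OF E, of q]
    by (simp add: map_poly_pCons hD)
  then show ?thesis
    unfolding unital_ring_hom_det[OF E]
    by (intro arg_cong[where f = det]) (simp add: vec_eq_iff map_poly_pCons hD)
qed

section \<open>Leading coefficients of characteristic polynomials and of shifted polynomials\<close>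

lemma coeff_mult_degree_bounds:
  assumes "degree p \<le> m" "degree q \<le> n"
  shows "coeff (p * q) (m + n) = coeff p m * coeff q n"
proof -
  have "coeff (p * q) (m + n) = (\<Sum>i\<le>m + n. if i = m then coeff p m * coeff q n else 0)"
    unfolding coeff_mult
  proof (intro sum.cong refl)
    fix i assume "i \<in> {..m + n}"
    show "coeff p i * coeff q (m + n - i) = (if i = m then coeff p m * coeff q n else 0)"
      using assms by (cases i m rule: linorder_cases) (auto simp: coeff_eq_0)
  qed
  then show ?thesis by simp
qed

lemma prod_degree_le_1:
  assumes "finite S" "\<And>i. i \<in> S \<Longrightarrow> degree (f i) \<le> 1"
  shows "degree (prod f S) \<le> card S \<and> coeff (prod f S) (card S) = (\<Prod>i\<in>S. coeff (f i) 1)"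
  using assms
proof (induction S rule: finite_induct)
  case (insert a S)
  then have IH: "degree (prod f S) \<le> card S" "coeff (prod f S) (card S) = (\<Prod>i\<in>S. coeff (f i) 1)"
    and a: "degree (f a) \<le> 1" by auto
  have "degree (f a * prod f S) \<le> 1 + card S"
    using degree_mult_le[of "f a" "prod f S"] IH(1) a by linarith
  then show ?case using insert.hyps coeff_mult_degree_bounds[OF a IH(1)] IH(2) by simp
qed simp

lemma det_degree_le_1:
  fixes M :: "('a::comm_ring_1) poly ^ 'n ^ 'n"
  assumes "\<And>i j. degree (M $ i $ j) \<le> 1"
  shows "degree (det M) \<le> CARD('n)" "coeff (det M) CARD('n) = det (\<chi> i j. coeff (M $ i $ j) 1)"
proof -
  have smult: "of_int k * p = smult (of_int k) p" for k and p :: "'a poly"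
    by (simp add: of_int_poly)
  have P: "degree (\<Prod>i\<in>UNIV. M $ i $ p i) \<le> CARD('n)"
    "coeff (\<Prod>i\<in>UNIV. M $ i $ p i) CARD('n) = (\<Prod>i\<in>UNIV. coeff (M $ i $ p i) 1)" for p
    using prod_degree_le_1[of UNIV "\<lambda>i. M $ i $ p i"] assms by auto
  show "degree (det M) \<le> CARD('n)"
    unfolding det_def smult
    by (intro degree_sum_le finite_permutations finite_class.finite_UNIV
        order_trans[OF degree_smult_le P(1)])
  show "coeff (det M) CARD('n) = det (\<chi> i j. coeff (M $ i $ j) 1)"
    unfolding det_def smult coeff_sum coeff_smult P(2) by simp
qed

text \<open>The linear coefficients of the entries form minus the identity matrix. The resulting
  power of -1 has square 1, hence is nonzero in any commutative ring with 1 distinct from 0, which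
  fixes the degree.\<close>

lemma charpoly_lead:
  fixes M :: "'a::comm_ring_1 ^ 'n ^ 'n"
  defines "P \<equiv> det (\<chi> i j. [:M $ i $ j:] - (if i = j then [:0, 1:] else 0))"
  shows "degree P = CARD('n)" "lead_coeff P = (-1) ^ CARD('n)"
proof -
  let ?B = "\<chi> i j. [:M $ i $ j:] - (if i = j then [:0, 1:] else 0)"
  have deg1: "degree (?B $ i $ j) \<le> 1" for i j
    by (auto intro!: degree_diff_le)
  have diag: "(\<chi> i j. coeff (?B $ i $ j) 1) = ((\<chi> i j. if i = j then - 1 else 0) :: 'a ^ 'n ^ 'n)"
    by (simp add: vec_eq_iff)
  have "coeff P CARD('n) = det ((\<chi> i j. if i = j then - 1 else 0) :: 'a ^ 'n ^ 'n)"
    unfolding P_def by (simp only: det_degree_le_1(2)[OF deg1] diag)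
  also have "\<dots> = (-1) ^ CARD('n)"
    by (subst det_diagonal) simp_all
  finally have co: "coeff P CARD('n) = (-1) ^ CARD('n)" .
  have "(-1::'a) ^ CARD('n) * (-1) ^ CARD('n) = 1" by (simp flip: power_mult_distrib)
  then have "coeff P CARD('n) \<noteq> 0" by (metis co mult_zero_left zero_neq_one)
  then have "CARD('n) \<le> degree P" by (rule le_degree)
  then show deg: "degree P = CARD('n)"
    using det_degree_le_1(1)[OF deg1] unfolding P_def by simp
  show "lead_coeff P = (-1) ^ CARD('n)" using co deg by simp
qed

text \<open>The formula for the second-highest coefficient is what later detects the spectral shift
  by a; the index \<open>Suc n\<close> avoids a truncated subtraction.\<close>

lemma pcompose_shift:
  assumes "degree p \<le> Suc n"
  shows "degree (pcompose p [:c, 1:]) \<le> Suc n"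
    "coeff (pcompose p [:c, 1:]) (Suc n) = coeff p (Suc n)"
    "coeff (pcompose p [:c, 1:]) n = coeff p n + of_nat (Suc n) * c * coeff p (Suc n)"
proof -
  show "degree (pcompose p [:c, 1:]) \<le> Suc n"
    using degree_pcompose_le[of p "[:c, 1:]"] assms by simp
  have "coeff (pcompose p [:c, 1:]) (Suc n) = coeff p (Suc n) \<and>
    coeff (pcompose p [:c, 1:]) n = coeff p n + of_nat (Suc n) * c * coeff p (Suc n)"
    using assms
  proof (induction n arbitrary: p)
    case 0
    obtain b q where p: "p = pCons b q" by (cases p)
    have "degree q = 0" using 0 p by (cases "q = 0") auto
    then obtain d where "q = [:d:]" by (metis degree_eq_zeroE)
    then show ?case by (simp add: p pcompose_pCons algebra_simps)
  next
    case (Suc n)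
    obtain b q where p: "p = pCons b q" by (cases p)
    have "degree q \<le> Suc n" using Suc.prems p by (cases "q = 0") auto
    note IH = Suc.IH[OF this]
    have "coeff (pcompose q [:c, 1:]) (Suc (Suc n)) = 0"
      "coeff q (Suc (Suc n)) = 0"
      using degree_pcompose_le[of q "[:c, 1:]"] \<open>degree q \<le> Suc n\<close> by (simp_all add: coeff_eq_0)
    then show ?case using IH
      by (simp add: p pcompose_pCons algebra_simps)
  qed
  then show "coeff (pcompose p [:c, 1:]) (Suc n) = coeff p (Suc n)"
    "coeff (pcompose p [:c, 1:]) n = coeff p n + of_nat (Suc n) * c * coeff p (Suc n)"
    by auto
qed

section \<open>Evaluation and translation of Laurent polynomials\<close>

definition monomial_eval :: "complex ^ 'd::finite \<Rightarrow> int ^ 'd \<Rightarrow> complex" where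
  "monomial_eval z m = (\<Prod>j\<in>UNIV. (z $ j) powi (m $ j))"

lemma monomial_eval_add:
  "(\<And>j. z $ j \<noteq> 0) \<Longrightarrow> monomial_eval z (a + b) = monomial_eval z a * monomial_eval z b"
  by (simp add: monomial_eval_def power_int_add prod.distrib)

lemma monomial_eval_0 [simp]: "monomial_eval z 0 = 1"
  by (simp add: monomial_eval_def)

lemma monomial_eval_mult:
  "monomial_eval (\<chi> j. w $ j * z $ j) m = monomial_eval w m * monomial_eval z m"
  by (simp add: monomial_eval_def power_int_mult_distrib prod.distrib)

lemma laurent_eval_superset:
  assumes "finite T" "keys p \<subseteq> T"
  shows "laurent_eval p z = (\<Sum>m\<in>T. lookup p m * monomial_eval z m)"
  unfolding laurent_eval_def monomial_eval_def
  by (intro sum.mono_neutral_left assms) (auto simp: in_keys_iff)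

lemma unital_ring_hom_laurent_eval:
  fixes z :: "complex ^ 'd::finite"
  assumes z: "\<And>j. z $ j \<noteq> 0"
  shows "unital_ring_hom (\<lambda>p. laurent_eval p z)"
  unfolding unital_ring_hom_def
proof (intro conjI allI)
  show "laurent_eval 0 z = 0" by (simp add: laurent_eval_def)
  show "laurent_eval 1 z = 1"
    by (subst laurent_eval_superset[of "{0}"]) (auto simp: lookup_one)
next
  fix p q :: "'d laurent"
  let ?T = "keys p \<union> keys q"
  show "laurent_eval (p + q) z = laurent_eval p z + laurent_eval q z"
    using keys_add[of p q]
    by (simp add: laurent_eval_superset[of ?T] lookup_add distrib_right sum.distrib)
next
  fix p q :: "'d laurent"
  define T where "T = (\<lambda>(a, b). a + b) ` (keys p \<times> keys q)"
  have T: "finite T" "keys (p * q) \<subseteq> T" using keys_mult[of p q] by (auto simp: T_def)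
  \<comment> \<open>T contains all of l + keys q, and outside that translate the shifted coefficient
    of \<open>q\<close> vanishes.\<close>
  have inner: "(\<Sum>k\<in>T. lookup q (k - l) * monomial_eval z (k - l)) = laurent_eval q z"
    if l: "l \<in> keys p" for l
  proof -
    have "(\<Sum>k\<in>T. lookup q (k - l) * monomial_eval z (k - l)) =
        (\<Sum>k\<in>(\<lambda>m. l + m) ` keys q. lookup q (k - l) * monomial_eval z (k - l))"
    proof (intro sum.mono_neutral_right ballI T)
      show "(\<lambda>m. l + m) ` keys q \<subseteq> T" using l by (auto simp: T_def)
      fix k assume k: "k \<in> T - (\<lambda>m. l + m) ` keys q"
      have "k - l \<notin> keys q"
      proof
        assume "k - l \<in> keys q"
        then have "l + (k - l) \<in> (\<lambda>m. l + m) ` keys q" by blast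
        then show False using k by simp
      qed
      then show "lookup q (k - l) * monomial_eval z (k - l) = 0" by (simp add: in_keys_iff)
    qed
    also have "\<dots> = (\<Sum>m\<in>keys q. lookup q m * monomial_eval z m)"
      by (subst sum.reindex) auto
    also have "\<dots> = laurent_eval q z" by (subst laurent_eval_superset[of "keys q"]) auto
    finally show ?thesis .
  qed
  have "laurent_eval (p * q) z =
      (\<Sum>k\<in>T. \<Sum>l\<in>keys p. lookup p l * lookup q (k - l) * monomial_eval z k)"
    by (simp add: laurent_eval_superset[OF T] lookup_mult_keys sum_distrib_right)
  also have "\<dots> = (\<Sum>l\<in>keys p. \<Sum>k\<in>T. lookup p l * lookup q (k - l) * monomial_eval z k)"
    by (rule sum.swap)
  also have "\<dots> = (\<Sum>l\<in>keys p. lookup p l * monomial_eval z l *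
      (\<Sum>k\<in>T. lookup q (k - l) * monomial_eval z (k - l)))"
    unfolding sum_distrib_left
  proof (intro sum.cong refl)
    fix l k
    have "monomial_eval z k = monomial_eval z l * monomial_eval z (k - l)"
      using monomial_eval_add[OF z, of l "k - l"] by simp
    then show "lookup p l * lookup q (k - l) * monomial_eval z k =
        lookup p l * monomial_eval z l * (lookup q (k - l) * monomial_eval z (k - l))"
      by simp
  qed
  also have "\<dots> = (\<Sum>l\<in>keys p. lookup p l * monomial_eval z l * laurent_eval q z)"
    by (simp add: inner)
  also have "\<dots> = laurent_eval p z * laurent_eval q z"
    by (simp add: laurent_eval_superset[of "keys p" p] sum_distrib_right)
  finally show "laurent_eval (p * q) z = laurent_eval p z * laurent_eval q z" .
qed

text \<open>The substitution of w z for z, carried out on coefficients. The coefficient at exponent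
  0 is left fixed.\<close>

definition translate :: "complex ^ 'd::finite \<Rightarrow> 'd laurent \<Rightarrow> 'd laurent" where
  "translate w p = Poly_Mapping.mapp (\<lambda>m c. monomial_eval w m * c) p"

lemma lookup_translate: "lookup (translate w p) m = monomial_eval w m * lookup p m"
  by (auto simp: translate_def lookup_mapp when_def in_keys_iff)

lemma laurent_eval_translate:
  "laurent_eval (translate w p) z = laurent_eval p (\<chi> j. w $ j * z $ j)"
proof -
  have "keys (translate w p) \<subseteq> keys p" by (auto simp: in_keys_iff lookup_translate)
  then show ?thesis
    by (simp add: laurent_eval_superset[of "keys p"] lookup_translate monomial_eval_mult mult_ac)
qed

lemma translate_minus_1_power: "translate w ((-1) ^ n) = (-1) ^ n"
  by (cases "even n") (auto intro!: poly_mapping_eqI simp: lookup_translate lookup_one when_def)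

section \<open>Zero sets and eigenvalues\<close>

definition torus :: "real ^ 'd \<Rightarrow> complex ^ 'd" where
  "torus k = (\<chi> l. exp (2 * of_real pi * \<i> * of_real (k $ l)))"

lemma torus_nonzero: "torus k $ j \<noteq> 0"
  by (simp add: torus_def)

lemma torus_add: "torus (k + k') = (\<chi> j. torus k' $ j * torus k $ j)"
  by (simp add: torus_def vec_eq_iff exp_add[symmetric] distrib_left add.commute)

lemma symb_torus: "symb Acal k $ i $ j = laurent_eval (Acal $ i $ j) (torus k)"
  by (simp add: symb_def torus_def)

lemma countable_exp_level: "countable {t::real. exp (2 * of_real pi * \<i> * of_real t) = \<zeta>}"
proof (cases "{t::real. exp (2 * of_real pi * \<i> * of_real t) = \<zeta>} = {}")
  case False
  then obtain t0 :: real where t0: "exp (2 * of_real pi * \<i> * of_real t0) = \<zeta>" by blast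
  have "{t::real. exp (2 * of_real pi * \<i> * of_real t) = \<zeta>} \<subseteq> range (\<lambda>n::int. t0 + of_int n)"
  proof
    fix t :: real assume "t \<in> {t::real. exp (2 * of_real pi * \<i> * of_real t) = \<zeta>}"
    then have "exp (2 * of_real pi * \<i> * of_real t) = exp (2 * of_real pi * \<i> * of_real t0)"
      using t0 by simp
    then obtain n :: int where
      "2 * of_real pi * \<i> * of_real t = 2 * of_real pi * \<i> * of_real t0 + (of_int (2 * n) * pi) * \<i>"
      unfolding exp_eq by blast
    then have "2 * pi * t = 2 * pi * (t0 + of_int n)"
      by (auto simp: complex_eq_iff algebra_simps)
    then have "t = t0 + of_int n" by simp
    then show "t \<in> range (\<lambda>n::int. t0 + of_int n)" by blast
  qed
  then show ?thesis by (rule countable_subset) simp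
qed simp

text \<open>On a line in direction v the Laurent polynomial is a function of the single quantity
  exp(2 pi i t). Since the weight separates the monomials of \<open>c\<close>, none of them merge,
  and the resulting one-variable polynomial is nonzero with finitely many roots.\<close>

lemma countable_zeros_on_line:
  fixes c :: "'d::finite laurent" and v :: "int ^ 'd"
  assumes c: "c \<noteq> 0" and inj: "inj_on (weight v) (keys c)"
  shows "countable {t::real. laurent_eval c (torus (x + t *\<^sub>R (\<chi> j. of_int (v $ j)))) = 0}"
proof -
  define e where "e t = exp (2 * of_real pi * \<i> * of_real t)" for t :: real
  have e0: "e t \<noteq> 0" for t by (simp add: e_def)
  \<comment> \<open>Factoring out the lowest power makes all remaining exponents nonnegative, so
    \<open>P\<close> is an ordinary polynomial.\<close>
  define N where "N = Min (weight v ` keys c)"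
  have N: "N \<le> weight v m" if "m \<in> keys c" for m using that by (simp add: N_def)
  define f where "f m = nat (weight v m - N)" for m
  have f_inj: "inj_on f (keys c)"
  proof (rule inj_onI)
    fix a b assume ab: "a \<in> keys c" "b \<in> keys c" "f a = f b"
    then have "weight v a = weight v b" using N[OF ab(1)] N[OF ab(2)] by (simp add: f_def)
    then show "a = b" using inj ab by (auto dest: inj_onD)
  qed
  define b where "b m = lookup c m * monomial_eval (torus x) m" for m
  define P where "P = (\<Sum>m\<in>keys c. monom (b m) (f m))"
  obtain m0 where m0: "m0 \<in> keys c" using top_weight_attained[OF c, of "\<lambda>_. 0"] by blast
  have "coeff P (f m0) = (\<Sum>m\<in>keys c. if m = m0 then b m0 else 0)"
    unfolding P_def coeff_sum coeff_monom using f_inj m0 by (intro sum.cong) (auto dest: inj_onD)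
  also have "\<dots> = b m0" using m0 by simp
  also have "\<dots> \<noteq> 0"
    using m0 by (simp add: b_def in_keys_iff monomial_eval_def torus_nonzero)
  finally have P0: "P \<noteq> 0" by auto
  have eval: "laurent_eval c (torus (x + t *\<^sub>R (\<chi> j. of_int (v $ j)))) = e t powi N * poly P (e t)" for t
  proof -
    have tor: "torus (t *\<^sub>R (\<chi> j. of_int (v $ j))) $ j = e t powi (v $ j)" for j
    proof -
      have "torus (t *\<^sub>R (\<chi> j. of_int (v $ j))) $ j =
          exp (of_int (v $ j) * (2 * of_real pi * \<i> * of_real t))"
        by (simp add: torus_def mult_ac)
      then show ?thesis by (simp add: e_def exp_power_int)
    qed
    have mono: "monomial_eval (torus (t *\<^sub>R (\<chi> j. of_int (v $ j)))) m = e t powi weight v m" for m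
    proof -
      have "e t powi (\<Sum>j\<in>S. v $ j * m $ j) = (\<Prod>j\<in>S. e t powi (v $ j * m $ j))" for S
        by (induction S rule: infinite_finite_induct) (auto simp: power_int_add e0)
      then show ?thesis by (simp add: monomial_eval_def tor power_int_mult weight_def)
    qed
    have "laurent_eval c (torus (x + t *\<^sub>R (\<chi> j. of_int (v $ j)))) =
        (\<Sum>m\<in>keys c. b m * e t powi weight v m)"
      by (simp add: laurent_eval_superset[of "keys c"] torus_add monomial_eval_mult mono b_def mult_ac)
    also have "\<dots> = (\<Sum>m\<in>keys c. e t powi N * (b m * e t ^ f m))"
    proof (intro sum.cong refl)
      fix m assume "m \<in> keys c"
      then have "weight v m = N + int (f m)" using N[of m] by (simp add: f_def)
      then have "e t powi weight v m = e t powi N * e t ^ f m" by (simp add: power_int_add e0)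
      then show "b m * e t powi weight v m = e t powi N * (b m * e t ^ f m)" by simp
    qed
    also have "\<dots> = e t powi N * poly P (e t)"
      by (simp add: P_def poly_sum poly_monom sum_distrib_left)
    finally show ?thesis .
  qed
  have "{t. laurent_eval c (torus (x + t *\<^sub>R (\<chi> j. of_int (v $ j)))) = 0} =
      (\<Union>\<zeta>\<in>{\<zeta>. poly P \<zeta> = 0}. {t. e t = \<zeta>})"
    by (auto simp: eval e0)
  moreover have "countable \<dots>"
    using poly_roots_finite[OF P0] countable_exp_level unfolding e_def
    by (intro countable_UN) (auto intro: countable_finite)
  ultimately show ?thesis by simp
qed

text \<open>Fubini for the pairs (x, t) with x + t u in \<open>E\<close>: each x admits a null set
  of t, so some fixed t admits a null set of x, and that set is a translate of \<open>E\<close>.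
  Closedness provides measurability.\<close>

lemma negligible_if_countable_on_lines:
  fixes E :: "(real ^ 'd::finite) set"
  assumes "closed E" and line: "\<And>x. countable {t::real. x + t *\<^sub>R u \<in> E}"
  shows "negligible E"
proof -
  have "{z::(real ^ 'd) \<times> real. fst z + snd z *\<^sub>R u \<notin> E} = (\<lambda>z. fst z + snd z *\<^sub>R u) -` (- E)"
    by auto
  moreover have "open \<dots>"
    using assms(1) by (intro open_vimage continuous_intros) auto
  ultimately have "{z::(real ^ 'd) \<times> real. fst z + snd z *\<^sub>R u \<notin> E} \<in> sets borel" by simp
  then have meas: "{z \<in> space (lborel \<Otimes>\<^sub>M lborel). fst z + snd z *\<^sub>R u \<notin> E} \<in>
      sets (lborel \<Otimes>\<^sub>M (lborel :: real measure))"
    by (simp only: lborel_prod sets_lborel space_lborel space_borel UNIV_I simp_thms)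
  have "AE x in lborel. AE t in lborel. x + t *\<^sub>R u \<notin> E"
  proof (rule AE_I2)
    fix x
    show "AE t in lborel. x + t *\<^sub>R u \<notin> E"
      using AE_not_in[OF countable_imp_null_set_lborel[OF line[of x]]] by simp
  qed
  then have "AE t in lborel. AE x in lborel. x + t *\<^sub>R u \<notin> E"
    using lborel_pair.AE_commute[OF meas] by simp
  \<comment> \<open>The real line is not null, so a property of almost every t holds for at least
    one t.\<close>
  moreover have "ae_filter (lborel :: real measure) \<noteq> bot" by (simp add: ae_filter_eq_bot_iff)
  ultimately obtain t :: real where "AE x in lborel. x + t *\<^sub>R u \<notin> E"
    using eventually_happens' by blast
  then have "AE x in lebesgue. x + t *\<^sub>R u \<notin> E" by (rule AE_completion)
  then have "negligible {x. x + t *\<^sub>R u \<in> E}"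
    by (simp add: completion.AE_iff_null_sets negligible_iff_null_sets)
  then have "negligible ((+) (t *\<^sub>R u) ` {x. x + t *\<^sub>R u \<in> E})" by (rule negligible_translation)
  moreover have "(+) (t *\<^sub>R u) ` {x. x + t *\<^sub>R u \<in> E} = E"
  proof
    show "E \<subseteq> (+) (t *\<^sub>R u) ` {x. x + t *\<^sub>R u \<in> E}"
    proof
      fix y assume "y \<in> E"
      then show "y \<in> (+) (t *\<^sub>R u) ` {x. x + t *\<^sub>R u \<in> E}"
        by (intro image_eqI[of _ _ "y - t *\<^sub>R u"]) auto
    qed
  qed (auto simp: add.commute)
  ultimately show ?thesis by simp
qed

lemma negligible_laurent_zeros:
  fixes c :: "'d::finite laurent"
  assumes "c \<noteq> 0"
  shows "negligible {k. laurent_eval c (torus k) = 0}"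
proof -
  obtain v :: "int ^ 'd" where v: "inj_on (weight v) (keys c)"
    using separating_weight[OF finite_keys[of c]] by blast
  have "continuous_on UNIV (\<lambda>k. laurent_eval c (torus k))"
    unfolding laurent_eval_def torus_def
    by (auto intro!: continuous_intros)
  then have "closed ((\<lambda>k. laurent_eval c (torus k)) -` {0})"
    by (intro closed_vimage) auto
  moreover have "(\<lambda>k. laurent_eval c (torus k)) -` {0} = {k. laurent_eval c (torus k) = 0}" by auto
  ultimately show ?thesis
    using countable_zeros_on_line[OF assms v] by (intro negligible_if_countable_on_lines) auto
qed

lemma poly_charP: "poly (map_poly (\<lambda>p. laurent_eval p (torus k)) (charP Acal)) x = poly (cpoly (symb Acal k)) x"
proof -
  have "unital_ring_hom (\<lambda>x. x :: complex)" by (simp add: unital_ring_hom_def)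
  from poly_map_poly_charpoly[OF this, of "symb Acal k" x]
  have "poly (cpoly (symb Acal k)) x = det (\<chi> i j. symb Acal k $ i $ j - (if i = j then x else 0))"
    by (simp add: cpoly_def)
  then show ?thesis
    unfolding charP_def poly_map_poly_charpoly[OF unital_ring_hom_laurent_eval[OF torus_nonzero]]
    by (simp add: symb_torus)
qed

section \<open>Eigenvalues of Hermitian matrices\<close>

lemma hermitian_eigenvalue_real:
  fixes M :: "complex ^ 'q::finite ^ 'q"
  assumes herm: "hermitian_mat M" and root: "poly (cpoly M) x = 0"
  shows "x \<in> \<real>"
proof -
  let ?B = "\<chi> i j. M $ i $ j - (if i = j then x else 0)"
  have "unital_ring_hom (\<lambda>x. x :: complex)" by (simp add: unital_ring_hom_def)
  from poly_map_poly_charpoly[OF this, of M x] have "det ?B = 0"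
    using root by (simp add: cpoly_def)
  then have "\<not> invertible ?B" by (simp add: invertible_det_nz)
  then obtain v where v: "?B *v v = 0" "v \<noteq> 0"
    unfolding invertible_left_inverse matrix_left_invertible_ker by blast
  have Mv: "(\<Sum>j\<in>UNIV. M $ i $ j * v $ j) = x * v $ i" for i
  proof -
    have "0 = (\<Sum>j\<in>UNIV. (M $ i $ j - (if i = j then x else 0)) * v $ j)"
      using v(1) by (simp add: matrix_vector_mult_def vec_eq_iff)
    also have "\<dots> = (\<Sum>j\<in>UNIV. M $ i $ j * v $ j) - (\<Sum>j\<in>UNIV. if i = j then x * v $ j else 0)"
      by (simp add: left_diff_distrib sum_subtractf if_distrib[of "\<lambda>y. y * _"] cong: if_cong)
    finally show ?thesis by simp
  qed
  \<comment> \<open>The Hermitian form of \<open>M\<close> at the eigenvector v; it equals x times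
    the squared norm \<open>N\<close> and is its own conjugate.\<close>
  define S where "S = (\<Sum>i\<in>UNIV. \<Sum>j\<in>UNIV. cnj (v $ i) * M $ i $ j * v $ j)"
  define N where "N = (\<Sum>i\<in>UNIV. (cmod (v $ i))\<^sup>2)"
  have "S = (\<Sum>i\<in>UNIV. cnj (v $ i) * (\<Sum>j\<in>UNIV. M $ i $ j * v $ j))"
    by (simp add: S_def sum_distrib_left mult.assoc)
  also have "\<dots> = x * of_real N"
    unfolding Mv N_def of_real_sum sum_distrib_left
    by (intro sum.cong refl) (simp only: complex_norm_square mult_ac)
  finally have S: "S = x * of_real N" .
  have "cnj S = (\<Sum>i\<in>UNIV. \<Sum>j\<in>UNIV. v $ i * cnj (M $ i $ j) * cnj (v $ j))"
    by (simp add: S_def)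
  also have "\<dots> = (\<Sum>i\<in>UNIV. \<Sum>j\<in>UNIV. cnj (v $ j) * M $ j $ i * v $ i)"
  proof (intro sum.cong refl)
    fix i j
    have "cnj (M $ i $ j) = M $ j $ i" using herm by (metis hermitian_mat_def)
    then show "v $ i * cnj (M $ i $ j) * cnj (v $ j) = cnj (v $ j) * M $ j $ i * v $ i" by simp
  qed
  also have "\<dots> = S" unfolding S_def by (rule sum.swap)
  finally have "cnj x * of_real N = x * of_real N" by (simp add: S)
  moreover have "N \<noteq> 0"
  proof
    assume "N = 0"
    then have "v $ i = 0" for i by (simp add: N_def sum_nonneg_eq_0_iff)
    then show False using v(2) by (simp add: vec_eq_iff)
  qed
  ultimately have "cnj x = x" by simp
  then show ?thesis by (simp add: Reals_cnj_iff)
qed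

text \<open>The sorted list has as many entries as the degree, so the index s - 1 is in range. Its
  entries are real parts of roots, which are the roots themselves because the matrix is
  Hermitian.\<close>

lemma poly_cpoly_eig:
  fixes M :: "complex ^ 'q::finite ^ 'q"
  assumes "hermitian_mat M" "s \<in> {1..CARD('q)}"
  shows "poly (cpoly M) (of_real (eig M s)) = 0"
proof -
  let ?R = "image_mset Re (proots (cpoly M))"
  have deg: "degree (cpoly M) = CARD('q)"
    unfolding cpoly_def by (rule charpoly_lead)
  then have "cpoly M \<noteq> 0" by (metis degree_0 zero_less_card_finite less_irrefl)
  have "length (sorted_list_of_multiset ?R) = size ?R"
    by (metis mset_sorted_list_of_multiset size_mset)
  then have "s - 1 < length (sorted_list_of_multiset ?R)"
    using assms(2) by (auto simp: size_proots_complex deg)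
  then have "eig M s \<in> set (sorted_list_of_multiset ?R)" unfolding eig_def by (rule nth_mem)
  then obtain x where x: "eig M s = Re x" "poly (cpoly M) x = 0"
    using \<open>cpoly M \<noteq> 0\<close> by auto
  then have "of_real (eig M s) = x" using hermitian_eigenvalue_real[OF assms(1) x(2)] by simp
  then show ?thesis using x(2) by simp
qed

theorem theorem2:
  fixes Acal :: "('d::finite laurent) ^ 'q::finite ^ 'q"
    and a :: real and \<alpha> :: "real ^ 'd"
  assumes herm: "\<And>k. hermitian_mat (symb Acal k)"
    and irred: "irreducible (charP Acal)"
    and a: "a \<noteq> 0"
  shows "{k :: real ^ 'd. \<exists>s\<in>{1..CARD('q)}. \<exists>w\<in>{1..CARD('q)}.
            eig (symb Acal (k + \<alpha>)) s = eig (symb Acal k) w + a} \<in> null_sets lebesgue"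
proof -
  define F where "F = charP Acal"
  define ca :: "'d laurent" where "ca = Poly_Mapping.single 0 (of_real a)"
  define F' where "F' = map_poly (translate (torus \<alpha>)) F"
  \<comment> \<open>With \<open>F'\<close> the translate of \<open>F\<close> by \<alpha>, this is
    P(w z, \<lambda> + a): over the point k, its roots are the eigenvalues at k + \<alpha> lowered
    by a.\<close>
  define G where "G = pcompose F' [:ca, 1:]"
  obtain n where n: "CARD('q) = Suc n" by (metis zero_less_card_finite gr0_implies_Suc)
  have F: "degree F = Suc n" "coeff F (Suc n) = (-1) ^ Suc n"
    using charpoly_lead[of Acal] by (simp_all add: F_def charP_def n)
  have tr0: "translate (torus \<alpha>) 0 = 0"
    by (auto intro!: poly_mapping_eqI simp: lookup_translate)
  have F': "degree F' \<le> Suc n" "coeff F' (Suc n) = (-1) ^ Suc n"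
    using map_poly_degree_leq[of "translate (torus \<alpha>)" F] F translate_minus_1_power[of "torus \<alpha>" "Suc n"]
    by (simp_all add: F'_def coeff_map_poly tr0)
  have G: "degree G \<le> Suc n" "coeff G (Suc n) = (-1) ^ Suc n"
    "coeff G n = coeff F' n + of_nat (Suc n) * ca * (-1) ^ Suc n"
    using pcompose_shift[OF F'(1), of ca] F'(2) by (simp_all only: G_def)
  have unit: "(-1 :: 'd laurent) ^ Suc n * (-1) ^ Suc n = 1" by (simp flip: power_mult_distrib)
  then have "coeff G (Suc n) \<noteq> 0" by (metis G(2) mult_zero_left zero_neq_one)
  then have degG: "degree G = Suc n" using G(1) le_degree by (metis antisym)
  have "F \<noteq> G"
  proof
    assume "F = G"
    \<comment> \<open>Translation fixes the coefficient at exponent 0, so at degree n the two sides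
      differ there by plus or minus (n + 1) a.\<close>
    then have "lookup (coeff F n) 0 = lookup (coeff G n) 0" by simp
    then have "lookup (of_nat (Suc n) * ca * (-1) ^ Suc n) 0 = 0"
      by (simp add: G(3) F'_def coeff_map_poly tr0 lookup_add lookup_translate del: of_nat_Suc power_Suc)
    then have "lookup (of_nat (Suc n) * ca) 0 = 0"
      by (cases "even n") simp_all
    moreover have "of_nat (Suc n) * ca = Poly_Mapping.single 0 (of_nat (Suc n) * of_real a)"
      by (simp only: ca_def of_nat_single comp_apply mult_single add_0)
    ultimately have "of_nat (Suc n) * (of_real a :: complex) = 0" by (simp del: of_nat_Suc)
    then show False using a by (simp del: of_nat_Suc)
  qed
  moreover have "irreducible F" "lead_coeff F * (-1) ^ Suc n = 1"
    using irred unit F by (simp_all only: F_def)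
  ultimately obtain X Y c where XY: "c \<noteq> 0" "X * F + Y * G = [:c:]"
    using irreducible_eq_or_comaximal_const[OF domain_ring_laurent
        completely_integrally_closed_laurent, of F G] F G degG
    by metis
  have "{k. \<exists>s\<in>{1..CARD('q)}. \<exists>w\<in>{1..CARD('q)}.
      eig (symb Acal (k + \<alpha>)) s = eig (symb Acal k) w + a} \<subseteq> {k. laurent_eval c (torus k) = 0}"
  proof clarify
    fix k s w assume s: "s \<in> {1..CARD('q)}" and w: "w \<in> {1..CARD('q)}"
      and eq: "eig (symb Acal (k + \<alpha>)) s = eig (symb Acal k) w + a"
    let ?h = "\<lambda>p. laurent_eval p (torus k)"
    \<comment> \<open>A common root: it is an eigenvalue at k, and adding a gives an eigenvalue at k
      + \<alpha>. Evaluating \<open>X * F + Y * G = [:c:]\<close> at it therefore forces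
      \<open>c\<close> to vanish at the torus point of k.\<close>
    let ?x = "of_real (eig (symb Acal k) w) :: complex"
    let ?E = "\<lambda>p. poly (map_poly ?h p) ?x"
    have h: "unital_ring_hom ?h" by (rule unital_ring_hom_laurent_eval[OF torus_nonzero])
    have E: "unital_ring_hom ?E" by (rule unital_ring_hom_poly_eval[OF h])
    have "?E F = 0" using poly_cpoly_eig[OF herm w] by (simp add: F_def poly_charP)
    moreover have "?E G = 0"
    proof -
      have "?h ca = of_real a"
        by (subst laurent_eval_superset[of "{0}"]) (auto simp: ca_def)
      then have "?E G = poly (map_poly ?h F') (of_real a + ?x)"
        unfolding G_def poly_map_poly_pcompose_shift[OF h] by simp
      also have "map_poly ?h F' = map_poly (?h \<circ> translate (torus \<alpha>)) F"
        unfolding F'_def by (intro map_poly_map_poly unital_ring_homD(1)[OF h] tr0)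
      also have "?h \<circ> translate (torus \<alpha>) = (\<lambda>p. laurent_eval p (torus (k + \<alpha>)))"
        by (simp add: fun_eq_iff laurent_eval_translate torus_add)
      also have "poly (map_poly \<dots> F) (of_real a + ?x) =
          poly (cpoly (symb Acal (k + \<alpha>))) (of_real (eig (symb Acal (k + \<alpha>)) s))"
        unfolding F_def poly_charP eq of_real_add add.commute[of "of_real a"] ..
      also have "\<dots> = 0" by (rule poly_cpoly_eig[OF herm s])
      finally show ?thesis .
    qed
    moreover have "?E [:c:] = ?h c" by (simp add: map_poly_pCons unital_ring_homD(1)[OF h])
    moreover have "?E [:c:] = ?E X * ?E F + ?E Y * ?E G"
      unfolding XY(2)[symmetric] unital_ring_homD(3,4)[OF E] ..
    ultimately show "?h c = 0" by simp
  qed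
  then have "negligible {k. \<exists>s\<in>{1..CARD('q)}. \<exists>w\<in>{1..CARD('q)}.
      eig (symb Acal (k + \<alpha>)) s = eig (symb Acal k) w + a}"
    using negligible_laurent_zeros[OF XY(1)] negligible_subset by blast
  then show ?thesis by (simp only: negligible_iff_null_sets)
qed

end
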